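(* Let $\varepsilon,m>0$. For every $\delta\in(0,1)$ there exists a unique pair of complex-valued functions $A_1(x,t)=A_1(x,t,m,\varepsilon,\delta)$, $A_2(x,t)=A_2(x,t,m,\varepsilon,\delta)$ on the set $L_\varepsilon:=\{(x,t)\in\mathbb{R}^2: 2x/\varepsilon,\ 2t/\varepsilon,\ (x+t)/\varepsilon\in\mathbb{Z}\}$ satisfying the following three axioms: (axiom 1) for each $(x,t)\in L_\varepsilon$ with $2x/\varepsilon$ and $2t/\varepsilon$ even, $$A_1(x,t)=\tfrac{1}{\sqrt{1+m^2\varepsilon^2}}\Big(A_1(x+\tfrac{\varepsilon}{2},t-\tfrac{\varepsilon}{2})+m\varepsilon\,A_2(x+\tfrac{\varepsilon}{2},t-\tfrac{\varepsilon}{2})\Big),$$ $$A_2(x,t)=\tfrac{1}{\sqrt{1+m^2\varepsilon^2}}\Big(A_2(x-\tfrac{\varepsilon}{2},t-\tfrac{\varepsilon}{2})-m\varepsilon\,A_1(x-\tfrac{\varepsilon}{2},t-\tfrac{\varepsilon}{2})\Big)+2\delta_{x0}\delta_{t0};$$ (axiom 2) for each $(x,t)\in L_\varepsilon$ with $2x/\varepsilon$ and $2t/\varepsilon$ odd, $$A_1(x,t)=\tfrac{1}{\sqrt{1-\delta^2}}\Big(A_1(x+\tfrac{\varepsilon}{2},t-\tfrac{\varepsilon}{2})-i\delta\,A_2(x+\tfrac{\varepsilon}{2},t-\tfrac{\varepsilon}{2})\Big),$$ $$A_2(x,t)=\tfrac{1}{\sqrt{1-\delta^2}}\Big(A_2(x-\tfrac{\varepsilon}{2},t-\tfrac{\varepsilon}{2})+i\delta\,A_1(x-\tfrac{\varepsilon}{2},t-\tfrac{\varepsilon}{2})\Big);$$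 (axiom 3) $\sum_{(x,t)\in\varepsilon\mathbb{Z}^2}\big(|A_1(x,t)|^2+|A_2(x,t)|^2\big)<\infty$. Moreover, for each $(x,t)\in\varepsilon\mathbb{Z}^2$ and $k\in\{1,2\}$ the limit $\widetilde{A}_k(x,t,m,\varepsilon):=\lim_{\delta\searrow0}A_k(x,t,m,\varepsilon,\delta)$ exists. If $(x+t)/\varepsilon+k$ is even, this limit is real and given by $$\widetilde{A}_1(x,t,m,\varepsilon)=a_1(x,|t|+\varepsilon,m,\varepsilon)\quad\text{for }(x+t)/\varepsilon\text{ odd},$$ $$\widetilde{A}_2(x,t,m,\varepsilon)=\pm a_2(\pm x+\varepsilon,|t|+\varepsilon,m,\varepsilon)\quad\text{for }(x+t)/\varepsilon\text{ even},$$ where both minus signs are taken when $t<0$ (and both plus signs when $t\ge0$). If $(x+t)/\varepsilon+k$ is odd, the limit is purely imaginary.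
   Context: $\delta_{xy}$ denotes the Kronecker delta ($1$ if $x=y$, $0$ otherwise). Feynman checkers: for $\varepsilon>0$, $m\ge0$, a checker path $s$ is a finite sequence of points of $\varepsilon\mathbb{Z}^2$ such that the vector from each point (except the last) to the next equals $(\varepsilon,\varepsilon)$ or $(-\varepsilon,\varepsilon)$; $\mathrm{turns}(s)$ is the number of points of $s$, other than the first and last, at which the vectors to the next point and from the previous point are orthogonal. Set $a(s):=(1+m^2\varepsilon^2)^{1-n/2}\,i\,(-im\varepsilon)^{\mathrm{turns}(s)}$, where $n$ is the number of points of $s$. For $(x,t)\in\varepsilon\mathbb{Z}^2$ with $t>0$, $a(x,t,m,\varepsilon):=\sum_s a(s)$ over all checker paths from $(0,0)$ to $(x,t)$ containing $(\varepsilon,\varepsilon)$ (empty sum is $0$), and $a_1:=\mathrm{Re}\,a$, $a_2:=\mathrm{Im}\,a$. *)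

theory Defs
  imports "HOL-Analysis.Analysis"
begin

definition epsZ2 :: "real \<Rightarrow> (real \<times> real) set" where
  "epsZ2 \<epsilon> = {(\<epsilon> * of_int a, \<epsilon> * of_int b) | a b :: int. True}"

definition checker_path :: "real \<Rightarrow> (real \<times> real) list \<Rightarrow> bool" where
  "checker_path \<epsilon> s \<longleftrightarrow> s \<noteq> [] \<and> set s \<subseteq> epsZ2 \<epsilon> \<and>
     (\<forall>i. i + 1 < length s \<longrightarrow>
        (fst (s ! (i+1)) - fst (s ! i), snd (s ! (i+1)) - snd (s ! i)) \<in> {(\<epsilon>, \<epsilon>), (-\<epsilon>, \<epsilon>)})"

definition turns :: "(real \<times> real) list \<Rightarrow> nat" where
  "turns s = card {i. 0 < i \<and> i + 1 < length s \<and>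
      (fst (s ! (i+1)) - fst (s ! i)) * (fst (s ! i) - fst (s ! (i-1))) +
      (snd (s ! (i+1)) - snd (s ! i)) * (snd (s ! i) - snd (s ! (i-1))) = 0}"

definition path_amp :: "real \<Rightarrow> real \<Rightarrow> (real \<times> real) list \<Rightarrow> complex" where
  "path_amp m \<epsilon> s = complex_of_real ((1 + m\<^sup>2 * \<epsilon>\<^sup>2) powr (1 - real (length s) / 2))
      * \<i> * (- \<i> * complex_of_real (m * \<epsilon>)) ^ turns s"

definition amp :: "real \<Rightarrow> real \<Rightarrow> real \<Rightarrow> real \<Rightarrow> complex" where
  "amp x t m \<epsilon> = (\<Sum>s \<in> {s. checker_path \<epsilon> s \<and> hd s = (0,0) \<and> last s = (x,t) \<and> (\<epsilon>,\<epsilon>) \<in> set s}.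
      path_amp m \<epsilon> s)"

definition a1 :: "real \<Rightarrow> real \<Rightarrow> real \<Rightarrow> real \<Rightarrow> real" where
  "a1 x t m \<epsilon> = Re (amp x t m \<epsilon>)"

definition a2 :: "real \<Rightarrow> real \<Rightarrow> real \<Rightarrow> real \<Rightarrow> real" where
  "a2 x t m \<epsilon> = Im (amp x t m \<epsilon>)"

definition Leps :: "real \<Rightarrow> (real \<times> real) set" where
  "Leps \<epsilon> = {(x,t). 2*x/\<epsilon> \<in> \<int> \<and> 2*t/\<epsilon> \<in> \<int> \<and> (x+t)/\<epsilon> \<in> \<int>}"

definition even_real :: "real \<Rightarrow> bool" where
  "even_real r \<longleftrightarrow> (\<exists>k::int. r = of_int k \<and> even k)"

definition odd_real :: "real \<Rightarrow> bool" where
  "odd_real r \<longleftrightarrow> (\<exists>k::int. r = of_int k \<and> odd k)"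

definition axiom1 :: "real \<Rightarrow> real \<Rightarrow> (real \<times> real \<Rightarrow> complex) \<Rightarrow> (real \<times> real \<Rightarrow> complex) \<Rightarrow> bool" where
  "axiom1 m \<epsilon> A1 A2 \<longleftrightarrow> (\<forall>x t. (x,t) \<in> Leps \<epsilon> \<and> even_real (2*x/\<epsilon>) \<and> even_real (2*t/\<epsilon>) \<longrightarrow>
     A1 (x,t) = complex_of_real (1 / sqrt (1 + m\<^sup>2 * \<epsilon>\<^sup>2)) *
        (A1 (x + \<epsilon>/2, t - \<epsilon>/2) + complex_of_real (m * \<epsilon>) * A2 (x + \<epsilon>/2, t - \<epsilon>/2)) \<and>
     A2 (x,t) = complex_of_real (1 / sqrt (1 + m\<^sup>2 * \<epsilon>\<^sup>2)) *
        (A2 (x - \<epsilon>/2, t - \<epsilon>/2) - complex_of_real (m * \<epsilon>) * A1 (x - \<epsilon>/2, t - \<epsilon>/2))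
        + 2 * (if x = 0 then 1 else 0) * (if t = 0 then 1 else 0))"

definition axiom2 :: "real \<Rightarrow> real \<Rightarrow> (real \<times> real \<Rightarrow> complex) \<Rightarrow> (real \<times> real \<Rightarrow> complex) \<Rightarrow> bool" where
  "axiom2 \<epsilon> \<delta> A1 A2 \<longleftrightarrow> (\<forall>x t. (x,t) \<in> Leps \<epsilon> \<and> odd_real (2*x/\<epsilon>) \<and> odd_real (2*t/\<epsilon>) \<longrightarrow>
     A1 (x,t) = complex_of_real (1 / sqrt (1 - \<delta>\<^sup>2)) *
        (A1 (x + \<epsilon>/2, t - \<epsilon>/2) - \<i> * complex_of_real \<delta> * A2 (x + \<epsilon>/2, t - \<epsilon>/2)) \<and>
     A2 (x,t) = complex_of_real (1 / sqrt (1 - \<delta>\<^sup>2)) *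
        (A2 (x - \<epsilon>/2, t - \<epsilon>/2) + \<i> * complex_of_real \<delta> * A1 (x - \<epsilon>/2, t - \<epsilon>/2)))"

definition axiom3 :: "real \<Rightarrow> (real \<times> real \<Rightarrow> complex) \<Rightarrow> (real \<times> real \<Rightarrow> complex) \<Rightarrow> bool" where
  "axiom3 \<epsilon> A1 A2 \<longleftrightarrow> (\<lambda>p. (cmod (A1 p))\<^sup>2 + (cmod (A2 p))\<^sup>2) summable_on epsZ2 \<epsilon>"

definition dirac_axioms :: "real \<Rightarrow> real \<Rightarrow> real \<Rightarrow> (real \<times> real \<Rightarrow> complex) \<Rightarrow> (real \<times> real \<Rightarrow> complex) \<Rightarrow> bool" where
  "dirac_axioms m \<epsilon> \<delta> A1 A2 \<longleftrightarrow> axiom1 m \<epsilon> A1 A2 \<and> axiom2 \<epsilon> \<delta> A1 A2 \<and> axiom3 \<epsilon> A1 A2"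

end

theory Submission
  imports Defs
begin

text \<open>
  Eliminating the odd points of the lattice turns the axioms into a first-order evolution on
  \<open>\<int>\<^sup>2\<close>, translation invariant except for a source at the origin. On Fourier modes
  \<open>exp (\<i> p x)\<close> it is a \<open>2 \<times> 2\<close> matrix of determinant 1 and trace \<open>2 \<tau>\<close>, where
  \<open>\<tau> = (cos p + \<i> m \<epsilon> \<delta>) / (sqrt (1 + m\<^sup>2 \<epsilon>\<^sup>2) sqrt (1 - \<delta>\<^sup>2))\<close>. For \<open>\<delta> > 0\<close> the eigenvalues are
  \<open>\<lambda>\<close> and \<open>1 / \<lambda>\<close> with \<open>\<lambda> = \<tau> - \<i> sqrt (1 - \<tau>\<^sup>2)\<close> and \<open>\<bar>\<lambda>\<bar> < 1\<close>; a square-summable solution must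
  follow the \<open>\<lambda>\<close>-eigenvector for \<open>t \<ge> 0\<close> and the other one for \<open>t < 0\<close>. These modes are continuous
  down to \<open>\<delta> = 0\<close>, so the limits exist and are given by the same integrals.

  Uniqueness: the difference of two solutions satisfies a wave equation with self-adjoint hopping
  terms and a purely imaginary mass term, so its norm vanishes. Uniqueness and a symmetry involving
  complex conjugation make each value real or purely imaginary according to parity. At \<open>\<delta> = 0\<close> the
  real parts obey the recursion of the checker-path sums, with the same values at \<open>t = 0\<close>.
\<close>

section \<open>Uniqueness on the integer lattice\<close>

text \<open>Product of the normalising factors of axioms 1 and 2. It is real and is taken as a
  complex number only to multiply field values directly.\<close>

definition hop :: "real \<Rightarrow> real \<Rightarrow> complex" where
  "hop \<mu> \<delta> = complex_of_real (1 / (sqrt (1 + \<mu>\<^sup>2) * sqrt (1 - \<delta>\<^sup>2)))"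

text \<open>The axioms on \<open>\<epsilon>\<int>\<^sup>2\<close> after substituting axiom 2 into axiom 1, with \<open>\<mu> = m \<epsilon>\<close> and coordinates
  in units of \<open>\<epsilon>\<close>; the source \<open>s\<close> is \<open>2\<close> for solutions and \<open>0\<close> for their differences.\<close>

definition evol ::
  "real \<Rightarrow> real \<Rightarrow> complex \<Rightarrow> (int \<Rightarrow> int \<Rightarrow> complex) \<Rightarrow> (int \<Rightarrow> int \<Rightarrow> complex) \<Rightarrow> bool" where
  "evol \<mu> \<delta> s f1 f2 \<longleftrightarrow> (\<forall>x t.
     f1 x t = hop \<mu> \<delta> * (f1 (x+1) (t-1) - \<i> * of_real \<delta> * f2 (x+1) (t-1)
        + of_real \<mu> * (f2 x (t-1) + \<i> * of_real \<delta> * f1 x (t-1))) \<and>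
     f2 x t = hop \<mu> \<delta> * (f2 (x-1) (t-1) + \<i> * of_real \<delta> * f1 (x-1) (t-1)
        - of_real \<mu> * (f1 x (t-1) - \<i> * of_real \<delta> * f2 x (t-1)))
        + (if x = 0 \<and> t = 0 then s else 0))"

text \<open>On Fourier modes the one-step matrix has determinant \<open>hop\<close> squared times
  \<open>(1 + \<mu>\<^sup>2) * (1 - \<delta>\<^sup>2)\<close>; the lemma says that this determinant
  is 1. The nesting of the product matches the factor that appears when the evolution is substituted
  into its inverse.\<close>

lemma hop_square:
  assumes "\<bar>\<delta>\<bar> < 1"
  shows "hop \<mu> \<delta> * (hop \<mu> \<delta> * ((1 + (of_real \<mu>)\<^sup>2) * (1 - (of_real \<delta>)\<^sup>2))) = 1"
proof -
  have "\<delta>\<^sup>2 < 1" using assms by (simp add: abs_square_less_1)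
  moreover have "1 + \<mu>\<^sup>2 > 0" by (simp add: add_pos_nonneg)
  ultimately have a: "sqrt (1 + \<mu>\<^sup>2) > 0" "sqrt (1 - \<delta>\<^sup>2) > 0"
    and b: "1 + \<mu>\<^sup>2 = (sqrt (1 + \<mu>\<^sup>2))\<^sup>2" "1 - \<delta>\<^sup>2 = (sqrt (1 - \<delta>\<^sup>2))\<^sup>2"
    by simp_all
  have "1 / (p * q) * (1 / (p * q) * (p\<^sup>2 * q\<^sup>2)) = 1" if "p > 0" "q > 0" for p q :: real
    using that by (simp add: field_simps power2_eq_square)
  from this[OF a, folded b] have "1 / (sqrt (1 + \<mu>\<^sup>2) * sqrt (1 - \<delta>\<^sup>2)) * (1 / (sqrt (1 + \<mu>\<^sup>2) * sqrt (1 - \<delta>\<^sup>2)) * ((1 + \<mu>\<^sup>2) * (1 - \<delta>\<^sup>2))) = 1" .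
  then have "complex_of_real (1 / (sqrt (1 + \<mu>\<^sup>2) * sqrt (1 - \<delta>\<^sup>2)) * (1 / (sqrt (1 + \<mu>\<^sup>2) * sqrt (1 - \<delta>\<^sup>2)) * ((1 + \<mu>\<^sup>2) * (1 - \<delta>\<^sup>2)))) = 1"
    by (simp only: of_real_1)
  then show ?thesis unfolding hop_def by simp
qed

text \<open>A step of determinant 1 is inverted by its adjugate. The source is added after the step,
  so it has to be subtracted from \<open>f2\<close> (giving \<open>g2\<close>) before
  inverting.\<close>

lemma evol_backward:
  assumes "evol \<mu> \<delta> s f1 f2" "\<bar>\<delta>\<bar> < 1"
    and src: "g2 = (\<lambda>x. f2 x t - (if x = 0 \<and> t = 0 then s else 0))"
  shows "f1 x (t-1) = hop \<mu> \<delta> * (f1 (x-1) t + \<i> * of_real \<delta> * g2 (x+1)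
           - of_real \<mu> * (g2 x - \<i> * of_real \<delta> * f1 x t))" (is ?A)
    and "f2 x (t-1) = hop \<mu> \<delta> * (g2 (x+1) - \<i> * of_real \<delta> * f1 (x-1) t
           + of_real \<mu> * (f1 x t + \<i> * of_real \<delta> * g2 x))" (is ?B)
proof -
  define C where "C = hop \<mu> \<delta>"
  \<comment> \<open>With \<open>D\<close> absorbing the imaginary unit, the identities to be checked
    are polynomial in \<open>C\<close>, \<open>D\<close>, \<open>u\<close> and the field values
    alone.\<close>
  define D where "D = \<i> * complex_of_real \<delta>"
  define u where "u = complex_of_real \<mu>"
  have "1 - (complex_of_real \<delta>)\<^sup>2 = 1 + D\<^sup>2"
    by (simp add: D_def power_mult_distrib)
  from hop_square[OF assms(2), of \<mu>, unfolded this]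
  have c: "C * (C * ((1 + u\<^sup>2) * (1 + D\<^sup>2))) = 1"
    by (simp only: C_def u_def)
  have e1: "f1 y t = C * (f1 (y+1) (t-1) - D * f2 (y+1) (t-1)
        + u * (f2 y (t-1) + D * f1 y (t-1)))" for y
    using assms(1) unfolding evol_def C_def D_def u_def by blast
  have e2: "g2 y = C * (f2 (y-1) (t-1) + D * f1 (y-1) (t-1)
        - u * (f1 y (t-1) - D * f2 y (t-1)))" for y
  proof -
    have "f2 y t = C * (f2 (y-1) (t-1) + D * f1 (y-1) (t-1)
        - u * (f1 y (t-1) - D * f2 y (t-1))) + (if y = 0 \<and> t = 0 then s else 0)"
      using assms(1) unfolding evol_def C_def D_def u_def by blast
    then show ?thesis by (simp add: src)
  qed
  note e = e1[of x] e1[of "x-1"] e2[of x] e2[of "x+1"] diff_add_cancel add_diff_cancel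
  have "C * (f1 (x-1) t + D * g2 (x+1) - u * (g2 x - D * f1 x t))
      = C * (C * ((1 + u\<^sup>2) * (1 + D\<^sup>2))) * f1 x (t-1)"
    unfolding e by algebra
  then show ?A unfolding c by (simp add: C_def D_def u_def)
  have "C * (g2 (x+1) - D * f1 (x-1) t + u * (f1 x t + D * g2 x))
      = C * (C * ((1 + u\<^sup>2) * (1 + D\<^sup>2))) * f2 x (t-1)"
    unfolding e by algebra
  then show ?B unfolding c by (simp add: C_def D_def u_def)
qed

text \<open>Cayley-Hamilton: for a matrix of determinant 1, the step plus its inverse is the trace
  times the identity. The two components therefore decouple and satisfy the same scalar
  equation.\<close>

lemma evol_wave:
  assumes "evol \<mu> \<delta> 0 f1 f2" "\<bar>\<delta>\<bar> < 1" and "f = f1 \<or> f = f2"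
  shows "f x (t+1) + f x (t-1)
    = hop \<mu> \<delta> * (f (x+1) t + f (x-1) t + 2 * \<i> * of_real (\<mu> * \<delta>) * f x t)"
proof -
  have z: "(\<lambda>x. f2 x t) = (\<lambda>x. f2 x t - (if x = 0 \<and> t = 0 then 0 else 0))" by simp
  note b = evol_backward[OF assms(1,2) z]
  have f: "f1 x (t+1) = hop \<mu> \<delta> * (f1 (x+1) t - \<i> * of_real \<delta> * f2 (x+1) t
        + of_real \<mu> * (f2 x t + \<i> * of_real \<delta> * f1 x t))"
     "f2 x (t+1) = hop \<mu> \<delta> * (f2 (x-1) t + \<i> * of_real \<delta> * f1 (x-1) t
        - of_real \<mu> * (f1 x t - \<i> * of_real \<delta> * f2 x t))"
    using assms(1)[unfolded evol_def, rule_format, of x "t+1"] by simp_all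
  show ?thesis
  proof (cases "f = f1")
    case True
    show ?thesis unfolding True f(1) b(1)[of x] by (simp add: algebra_simps)
  next
    case False
    then have "f = f2" using assms(3) by simp
    show ?thesis unfolding \<open>f = f2\<close> f(2) b(2)[of x] by (simp add: algebra_simps)
  qed
qed

section \<open>Square-summable solutions of the homogeneous wave equation\<close>

lemma infsum_prod_int_shift:
  fixes g :: "int \<times> int \<Rightarrow> complex"
  shows "(\<Sum>\<^sub>\<infinity>p\<in>UNIV. g (fst p + a, snd p + b)) = (\<Sum>\<^sub>\<infinity>p\<in>UNIV. g p)"
proof (rule infsum_reindex_bij_betw[of "\<lambda>p. (fst p + a, snd p + b)"])
  show "bij_betw (\<lambda>p. (fst p + a, snd p + b)) UNIV (UNIV :: (int \<times> int) set)"
    by (rule bij_betw_byWitness[where f' = "\<lambda>p. (fst p - a, snd p - b)"]) auto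
qed

lemma summable_prod_int_shift:
  fixes g :: "int \<times> int \<Rightarrow> 'a :: {comm_monoid_add, t2_space}"
  assumes "g summable_on UNIV"
  shows "(\<lambda>p. g (fst p + a, snd p + b)) summable_on UNIV"
proof -
  have "bij_betw (\<lambda>p. (fst p + a, snd p + b)) UNIV (UNIV :: (int \<times> int) set)"
    by (rule bij_betw_byWitness[where f' = "\<lambda>p. (fst p - a, snd p - b)"]) auto
  from summable_on_reindex_bij_betw[OF this, of g] show ?thesis using assms by simp
qed

lemma summable_cnj_mult_shift:
  fixes f :: "int \<times> int \<Rightarrow> complex"
  assumes "(\<lambda>p. (cmod (f p))\<^sup>2) summable_on UNIV"
  shows "(\<lambda>p. cnj (f p) * f (fst p + a, snd p + b)) summable_on UNIV"
proof (rule abs_summable_summable, rule Infinite_Sum.abs_summable_on_comparison_test')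
  show "(\<lambda>p. (cmod (f p))\<^sup>2 + (cmod (f (fst p + a, snd p + b)))\<^sup>2) summable_on UNIV"
    by (intro summable_on_add assms summable_prod_int_shift[where g = "\<lambda>p. (cmod (f p))\<^sup>2"])
  fix p
  have "0 \<le> (cmod (f p) - cmod (f (fst p + a, snd p + b)))\<^sup>2" by simp
  moreover have "0 \<le> (cmod (f p))\<^sup>2 + (cmod (f (fst p + a, snd p + b)))\<^sup>2" by simp
  ultimately show "norm (cnj (f p) * f (fst p + a, snd p + b))
      \<le> (cmod (f p))\<^sup>2 + (cmod (f (fst p + a, snd p + b)))\<^sup>2"
    unfolding power2_diff norm_mult complex_mod_cnj by linarith
qed

text \<open>The adjoint of a translation is the opposite translation, by reindexing the sum. Hence
  the sum of two opposite translations pairs with \<open>f\<close> to a real number.\<close>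

lemma infsum_cnj_mult_shift:
  fixes f :: "int \<times> int \<Rightarrow> complex"
  shows "(\<Sum>\<^sub>\<infinity>p\<in>UNIV. cnj (f p) * f (fst p - a, snd p - b))
       = cnj (\<Sum>\<^sub>\<infinity>p\<in>UNIV. cnj (f p) * f (fst p + a, snd p + b))"
proof -
  have "(\<Sum>\<^sub>\<infinity>p\<in>UNIV. cnj (f p) * f (fst p - a, snd p - b))
      = (\<Sum>\<^sub>\<infinity>p\<in>UNIV. cnj (f (fst p + a, snd p + b)) * f (fst p, snd p))"
    using infsum_prod_int_shift[of "\<lambda>p. cnj (f p) * f (fst p - a, snd p - b)" a b] by simp
  also have "\<dots> = (\<Sum>\<^sub>\<infinity>p\<in>UNIV. cnj (cnj (f p) * f (fst p + a, snd p + b)))"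
    by (simp add: mult.commute)
  finally show ?thesis by (simp only: infsum_cnj)
qed

text \<open>Both hopping terms are self-adjoint on the square-summable functions, so pairing the
  equation with \<open>f\<close> and taking imaginary parts leaves only the term with \<open>\<eta>\<close>.\<close>

lemma damped_wave_eq_0:
  fixes f :: "int \<Rightarrow> int \<Rightarrow> complex" and c \<eta> :: real
  assumes wave: "\<And>x t. f x (t+1) + f x (t-1) = of_real c * (f (x+1) t + f (x-1) t) + \<i> * of_real \<eta> * f x t"
    and "\<eta> \<noteq> 0" and l2: "(\<lambda>(x, t). (cmod (f x t))\<^sup>2) summable_on UNIV"
  shows "f x t = 0"
proof -
  define F where "F = (\<lambda>p. f (fst p) (snd p))"
  have l2': "(\<lambda>p. (cmod (F p))\<^sup>2) summable_on UNIV"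
    using l2 by (simp add: F_def case_prod_unfold)
  define S where "S a b = (\<Sum>\<^sub>\<infinity>p\<in>UNIV. cnj (F p) * F (fst p + a, snd p + b))" for a b
  have S: "((\<lambda>p. cnj (F p) * F (fst p + a, snd p + b)) has_sum S a b) UNIV" for a b
    unfolding S_def by (rule has_sum_infsum, rule summable_cnj_mult_shift[OF l2'])
  have Sneg: "S (- a) (- b) = cnj (S a b)" for a b
    using infsum_cnj_mult_shift[of F a b] by (simp add: S_def)
  have "((\<lambda>p. cnj (F p) * F (fst p + 0, snd p + 1) + cnj (F p) * F (fst p + 0, snd p + (-1)))
      has_sum (S 0 1 + S 0 (-1))) UNIV" (is "(?L has_sum _) _")
    by (intro has_sum_add S)
  moreover have "((\<lambda>p. of_real c * (cnj (F p) * F (fst p + 1, snd p + 0) + cnj (F p) * F (fst p + (-1), snd p + 0))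
       + \<i> * of_real \<eta> * (cnj (F p) * F (fst p + 0, snd p + 0)))
      has_sum (of_real c * (S 1 0 + S (-1) 0) + \<i> * of_real \<eta> * S 0 0)) UNIV" (is "(?R has_sum _) _")
    by (intro has_sum_add has_sum_cmult_right S)
  moreover have "?L = ?R"
  proof
    fix p
    show "?L p = ?R p"
      using arg_cong[OF wave[of "fst p" "snd p"], of "\<lambda>z. cnj (F p) * z"]
      by (simp add: F_def algebra_simps)
  qed
  ultimately have eq: "S 0 1 + S 0 (-1) = of_real c * (S 1 0 + S (-1) 0) + \<i> * of_real \<eta> * S 0 0"
    using has_sum_unique[where f = ?L] by simp
  have "Im (S 0 1 + S 0 (-1)) = 0" "Im (S 1 0 + S (-1) 0) = 0"
    using Sneg[of 0 1] Sneg[of 1 0] by simp_all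
  with arg_cong[OF eq, of Im] have "\<eta> * Re (S 0 0) = 0" by simp
  then have "Re (S 0 0) = 0" using \<open>\<eta> \<noteq> 0\<close> by simp
  moreover have "((\<lambda>p. Re (cnj (F p) * F (fst p + 0, snd p + 0))) has_sum Re (S 0 0)) UNIV"
    by (rule has_sum_Re[OF S])
  moreover have "Re (cnj (F p) * F (fst p + 0, snd p + 0)) = (cmod (F p))\<^sup>2" for p
    by (simp add: cmod_power2) (simp add: power2_eq_square)
  ultimately have "((\<lambda>p. (cmod (F p))\<^sup>2) has_sum 0) UNIV" by simp
  then have "(cmod (F (x, t)))\<^sup>2 = 0"
    by (rule nonneg_has_sum_le_0D) auto
  then show ?thesis by (simp add: F_def)
qed

text \<open>The difference of two solutions has source 0, so each of its components satisfies the
  wave equation with imaginary mass. The bound of \<open>(cmod (a - b))\<^sup>2\<close> by twice the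
  sum of squares keeps it square-summable.\<close>

lemma evol_unique:
  assumes "\<mu> \<noteq> 0" "0 < \<delta>" "\<delta> < 1"
    and f: "evol \<mu> \<delta> s f1 f2" "(\<lambda>(x, t). (cmod (f1 x t))\<^sup>2 + (cmod (f2 x t))\<^sup>2) summable_on UNIV"
    and g: "evol \<mu> \<delta> s g1 g2" "(\<lambda>(x, t). (cmod (g1 x t))\<^sup>2 + (cmod (g2 x t))\<^sup>2) summable_on UNIV"
  shows "f1 = g1" "f2 = g2"
proof -
  define h1 where "h1 = (\<lambda>x t. f1 x t - g1 x t)"
  define h2 where "h2 = (\<lambda>x t. f2 x t - g2 x t)"
  have h: "evol \<mu> \<delta> 0 h1 h2"
    unfolding evol_def
  proof (intro allI)
    fix x t
    note ef = f(1)[unfolded evol_def, rule_format, of x t]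
    note eg = g(1)[unfolded evol_def, rule_format, of x t]
    show "h1 x t = hop \<mu> \<delta> * (h1 (x+1) (t-1) - \<i> * of_real \<delta> * h2 (x+1) (t-1)
        + of_real \<mu> * (h2 x (t-1) + \<i> * of_real \<delta> * h1 x (t-1))) \<and>
     h2 x t = hop \<mu> \<delta> * (h2 (x-1) (t-1) + \<i> * of_real \<delta> * h1 (x-1) (t-1)
        - of_real \<mu> * (h1 x (t-1) - \<i> * of_real \<delta> * h2 x (t-1)))
        + (if x = 0 \<and> t = 0 then 0 else 0)"
      unfolding h1_def h2_def ef[THEN conjunct1] ef[THEN conjunct2] eg[THEN conjunct1] eg[THEN conjunct2]
      by (simp add: algebra_simps)
  qed
  have sq: "(cmod (a - b))\<^sup>2 \<le> 2 * (cmod a)\<^sup>2 + 2 * (cmod b)\<^sup>2" for a b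
  proof -
    have "(cmod (a - b))\<^sup>2 \<le> (cmod a + cmod b)\<^sup>2"
      by (intro power_mono norm_triangle_ineq4) simp
    also have "\<dots> \<le> 2 * (cmod a)\<^sup>2 + 2 * (cmod b)\<^sup>2"
      using zero_le_power2[of "cmod a - cmod b"] unfolding power2_diff power2_sum by linarith
    finally show ?thesis .
  qed
  have sum: "(\<lambda>p. 2 * (case p of (x, t) \<Rightarrow> (cmod (f1 x t))\<^sup>2 + (cmod (f2 x t))\<^sup>2)
            + 2 * (case p of (x, t) \<Rightarrow> (cmod (g1 x t))\<^sup>2 + (cmod (g2 x t))\<^sup>2)) summable_on UNIV"
    by (intro summable_on_add summable_on_cmult_right f g)
  have "(\<lambda>(x, t). (cmod (h1 x t))\<^sup>2) summable_on UNIV" "(\<lambda>(x, t). (cmod (h2 x t))\<^sup>2) summable_on UNIV"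
    by (rule summable_on_comparison_test[OF sum];
        auto simp: h1_def h2_def intro!: order.trans[OF sq])+
  moreover define c where "c = 1 / (sqrt (1 + \<mu>\<^sup>2) * sqrt (1 - \<delta>\<^sup>2))"
  have dc: "hop \<mu> \<delta> = of_real c" by (simp add: hop_def c_def)
  have "\<delta>\<^sup>2 < 1" using assms(2,3) by (simp add: abs_square_less_1)
  moreover have "1 + \<mu>\<^sup>2 > 0" by (simp add: add_pos_nonneg)
  ultimately have "c \<noteq> 0" by (simp add: c_def)
  \<comment> \<open>This is the coefficient of the imaginary mass term. It vanishes at \<delta> = 0,
    so there the argument breaks down, and facts about \<delta> = 0 are later obtained as limits or
    directly from the integrals.\<close>
  then have "2 * c * (\<mu> * \<delta>) \<noteq> 0" using assms by simp
  have zero: "h x t = 0" if "h = h1 \<or> h = h2" for h x t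
  proof (rule damped_wave_eq_0[where \<eta> = "2 * c * (\<mu> * \<delta>)" and c = c])
    fix x t
    have "\<bar>\<delta>\<bar> < 1" using assms by simp
    from evol_wave[OF h this that, of x t]
    show "h x (t + 1) + h x (t - 1) = of_real c * (h (x + 1) t + h (x - 1) t)
        + \<i> * of_real (2 * c * (\<mu> * \<delta>)) * h x t"
      unfolding dc by (simp add: algebra_simps)
  next
    show "(\<lambda>(x, t). (cmod (h x t))\<^sup>2) summable_on UNIV"
      using that \<open>(\<lambda>(x, t). (cmod (h1 x t))\<^sup>2) summable_on UNIV\<close>
        \<open>(\<lambda>(x, t). (cmod (h2 x t))\<^sup>2) summable_on UNIV\<close> by auto
  qed fact
  show "f1 = g1" "f2 = g2"
    using zero[of h1] zero[of h2] by (auto simp: h1_def h2_def fun_eq_iff)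
qed

text \<open>Complex conjugation combined with the sign \<open>(-1)\<^sup>x\<^sup>+\<^sup>t\<^sup>+\<^sup>k\<close> on \<open>f\<^sub>k\<close> is a symmetry of the system:
  the real coefficients preserve the parity of \<open>x + t + k\<close> and the imaginary ones flip it.\<close>

lemma evol_parity:
  assumes "\<mu> \<noteq> 0" "0 < \<delta>" "\<delta> < 1" "cnj s = s"
    and f: "evol \<mu> \<delta> s f1 f2" "(\<lambda>(x, t). (cmod (f1 x t))\<^sup>2 + (cmod (f2 x t))\<^sup>2) summable_on UNIV"
  shows "even (x + t + 1) \<Longrightarrow> Im (f1 x t) = 0" "odd (x + t + 1) \<Longrightarrow> Re (f1 x t) = 0"
    and "even (x + t + 2) \<Longrightarrow> Im (f2 x t) = 0" "odd (x + t + 2) \<Longrightarrow> Re (f2 x t) = 0"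
proof -
  define sg :: "int \<Rightarrow> complex" where "sg n = (if even n then 1 else -1)" for n
  define g1 where "g1 = (\<lambda>x t. sg (x + t + 1) * cnj (f1 x t))"
  define g2 where "g2 = (\<lambda>x t. sg (x + t + 2) * cnj (f2 x t))"
  have "evol \<mu> \<delta> s g1 g2"
    unfolding evol_def
  proof (intro allI)
    fix x t
    note ef = f(1)[unfolded evol_def, rule_format, of x t]
    have "cnj (hop \<mu> \<delta>) = hop \<mu> \<delta>" by (simp add: hop_def)
    then show "g1 x t = hop \<mu> \<delta> * (g1 (x+1) (t-1) - \<i> * of_real \<delta> * g2 (x+1) (t-1)
        + of_real \<mu> * (g2 x (t-1) + \<i> * of_real \<delta> * g1 x (t-1))) \<and>
     g2 x t = hop \<mu> \<delta> * (g2 (x-1) (t-1) + \<i> * of_real \<delta> * g1 (x-1) (t-1)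
        - of_real \<mu> * (g1 x (t-1) - \<i> * of_real \<delta> * g2 x (t-1)))
        + (if x = 0 \<and> t = 0 then s else 0)"
      unfolding g1_def g2_def ef[THEN conjunct1] ef[THEN conjunct2]
      using assms(4) by (auto simp: sg_def algebra_simps)
  qed
  moreover have "(\<lambda>(x, t). (cmod (g1 x t))\<^sup>2 + (cmod (g2 x t))\<^sup>2) summable_on UNIV"
    using f(2) by (simp add: g1_def g2_def sg_def norm_mult if_distrib[of cmod] cong: if_cong)
  ultimately have eq: "f1 = g1" "f2 = g2"
    using evol_unique[OF assms(1-3) f] by auto
  have "f1 x t = sg (x + t + 1) * cnj (f1 x t)" "f2 x t = sg (x + t + 2) * cnj (f2 x t)"
    using eq by (metis g1_def, metis g2_def)
  then show "even (x + t + 1) \<Longrightarrow> Im (f1 x t) = 0" "odd (x + t + 1) \<Longrightarrow> Re (f1 x t) = 0"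
     "even (x + t + 2) \<Longrightarrow> Im (f2 x t) = 0" "odd (x + t + 2) \<Longrightarrow> Re (f2 x t) = 0"
    by (auto simp: sg_def complex_eq_iff)
qed

section \<open>Fourier coefficients\<close>

text \<open>The sign of the exponent is chosen so that multiplication by \<open>cis p\<close>
  becomes the shift from \<open>x\<close> to \<open>x + 1\<close>, which is how the hopping terms of
  \<open>evol\<close> are written.\<close>

definition fcoef :: "(real \<Rightarrow> complex) \<Rightarrow> int \<Rightarrow> complex" where
  "fcoef g x = integral {-pi..pi} (\<lambda>p. g p * cis (of_int x * p)) / of_real (2 * pi)"

lemma has_integral_fcoef:
  assumes "continuous_on {-pi..pi} g"
  shows "((\<lambda>p. g p * cis (of_int x * p)) has_integral (2 * pi * fcoef g x)) {-pi..pi}"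
proof -
  have "(\<lambda>p. g p * cis (of_int x * p)) integrable_on {-pi..pi}"
    by (intro integrable_continuous_real continuous_intros assms)
  from integrable_integral[OF this] show ?thesis by (simp add: fcoef_def)
qed

lemma fcoefI:
  fixes c :: complex
  assumes "((\<lambda>p. g p * cis (of_int x * p)) has_integral (2 * pi * c)) {-pi..pi}"
  shows "fcoef g x = c"
  using integral_unique[OF assms] by (simp add: fcoef_def)

lemma fcoef_add:
  assumes "continuous_on {-pi..pi} g" "continuous_on {-pi..pi} h"
  shows "fcoef (\<lambda>p. g p + h p) x = fcoef g x + fcoef h x"
  by (rule fcoefI)
    (use has_integral_add[OF has_integral_fcoef[OF assms(1), of x] has_integral_fcoef[OF assms(2), of x]]
      in \<open>simp add: algebra_simps\<close>)

lemma fcoef_diff: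
  assumes "continuous_on {-pi..pi} g" "continuous_on {-pi..pi} h"
  shows "fcoef (\<lambda>p. g p - h p) x = fcoef g x - fcoef h x"
  by (rule fcoefI)
    (use has_integral_diff[OF has_integral_fcoef[OF assms(1), of x] has_integral_fcoef[OF assms(2), of x]]
      in \<open>simp add: algebra_simps\<close>)

lemma fcoef_mult_left:
  "fcoef (\<lambda>p. c * g p) x = c * fcoef g x"
  by (simp add: fcoef_def mult.assoc)

lemma fcoef_cis:
  "fcoef (\<lambda>p. g p * cis p) x = fcoef g (x + 1)"
  "fcoef (\<lambda>p. g p * cis (- p)) x = fcoef g (x - 1)"
  by (simp_all add: fcoef_def mult.assoc cis_mult distrib_right left_diff_distrib add.commute)

lemma has_integral_cis_of_int:
  "((\<lambda>p. cis (of_int n * p)) has_integral (if n = 0 then 2 * pi else 0)) {-pi..pi}"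
proof (cases "n = 0")
  case True
  then show ?thesis using has_integral_const_real[of "1::complex" "-pi" pi] by (simp add: scaleR_conv_of_real)
next
  case False
  have "((\<lambda>p. cis (of_int n * p)) has_integral
      (cis (of_int n * pi) / (\<i> * of_int n) - cis (of_int n * (- pi)) / (\<i> * of_int n))) {-pi..pi}"
  proof (rule fundamental_theorem_of_calculus)
    fix p
    have "((\<lambda>z. exp (\<i> * of_int n * z) / (\<i> * of_int n)) has_field_derivative
        exp (\<i> * of_int n * of_real p)) (at (of_real p))"
      using False by (auto intro!: derivative_eq_intros)
    from has_vector_derivative_real_field[OF this]
    have "((\<lambda>p. exp (\<i> * of_real (of_int n * p)) / (\<i> * of_int n)) has_vector_derivative
        exp (\<i> * of_real (of_int n * p))) (at p within {-pi..pi})"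
      by (simp add: mult.assoc)
    then show "((\<lambda>p. cis (of_int n * p) / (\<i> * of_int n)) has_vector_derivative cis (of_int n * p))
        (at p within {-pi..pi})"
      by (simp only: cis_conv_exp)
  qed simp
  moreover have "cis (of_int n * pi) = cis (of_int n * (- pi))"
    using sin_npi_int[of n] by (simp add: complex_eq_iff mult.commute)
  ultimately show ?thesis using False by simp
qed

lemma fcoef_1: "fcoef (\<lambda>_. 1) x = (if x = 0 then 1 else 0)"
  by (rule fcoefI) (use has_integral_cis_of_int[of x] in \<open>auto split: if_splits\<close>)

text \<open>Bessel's inequality, with the mean square of \<open>g\<close> replaced by the square of
  a sup bound. It comes from integrating the nonnegative function
  \<open>(cmod (g p - s p))\<^sup>2\<close>, where \<open>s\<close> is the partial Fourier sum over
  \<open>X\<close>.\<close>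

lemma fcoef_bessel:
  assumes g: "continuous_on {-pi..pi} g" and M: "\<And>p. p \<in> {-pi..pi} \<Longrightarrow> cmod (g p) \<le> M"
    and "finite X"
  shows "(\<Sum>x\<in>X. (cmod (fcoef g x))\<^sup>2) \<le> M\<^sup>2"
proof -
  define a where "a = fcoef g"
  \<comment> \<open>The minus sign makes \<open>s\<close> a partial sum of the Fourier series of
    \<open>g\<close>, since \<open>fcoef\<close> integrates against \<open>cis (x p)\<close> with a
    plus sign.\<close>
  define s where "s p = (\<Sum>x\<in>X. a x * cis (of_int (- x) * p))" for p
  define S where "S = (\<Sum>x\<in>X. (cmod (a x))\<^sup>2)"
  have s: "continuous_on A s" for A
    unfolding s_def by (intro continuous_intros)
  have cs: "cnj (s p) = (\<Sum>x\<in>X. cnj (a x) * cis (of_int x * p))" for p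
    unfolding s_def cnj_sum by (rule sum.cong) (simp_all add: cis_cnj)
  have aa: "cnj (a x) * a x = of_real ((cmod (a x))\<^sup>2)" for x
    by (metis complex_norm_square mult.commute)
  have "((\<lambda>p. \<Sum>x\<in>X. cnj (a x) * (g p * cis (of_int x * p))) has_integral
      (\<Sum>x\<in>X. cnj (a x) * (2 * pi * a x))) {-pi..pi}"
    unfolding a_def by (intro has_integral_sum assms has_integral_mult_right has_integral_fcoef)
  moreover have "(\<Sum>x\<in>X. cnj (a x) * (2 * pi * a x)) = 2 * pi * S"
    unfolding S_def of_real_sum of_real_mult sum_distrib_left
    by (rule sum.cong[OF refl]) (simp only: aa[symmetric] mult_ac of_real_mult of_real_numeral)
  ultimately have gs: "((\<lambda>p. g p * cnj (s p)) has_integral (2 * pi * S)) {-pi..pi}"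
    unfolding cs by (simp add: sum_distrib_left mult_ac)
  \<comment> \<open>By orthogonality \<open>s\<close> has the same coefficients on \<open>X\<close>
    as \<open>g\<close>, so pairing \<open>g\<close> with \<open>s\<close> and pairing
    \<open>s\<close> with itself give the same value \<open>2 * pi * S\<close>.\<close>
  have inner: "((\<lambda>p. s p * cis (of_int y * p)) has_integral (2 * pi * a y)) {-pi..pi}" if "y \<in> X" for y
  proof -
    have "((\<lambda>p. \<Sum>x\<in>X. a x * cis (of_int (y - x) * p)) has_integral
        (\<Sum>x\<in>X. a x * (if y - x = 0 then 2 * pi else 0))) {-pi..pi}"
      by (intro has_integral_sum assms has_integral_mult_right has_integral_cis_of_int)
    moreover have "(\<Sum>x\<in>X. a x * (if y - x = 0 then 2 * pi else 0)) = (\<Sum>x\<in>X. if x = y then 2 * pi * a x else 0)"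
      by (rule sum.cong) auto
    moreover have "\<dots> = 2 * pi * a y"
      using that \<open>finite X\<close> by simp
    moreover have "(\<Sum>x\<in>X. a x * cis (of_int (y - x) * p)) = s p * cis (of_int y * p)" for p
      unfolding s_def sum_distrib_right
      by (rule sum.cong) (simp_all add: mult.assoc cis_mult algebra_simps)
    ultimately show ?thesis by simp
  qed
  have "((\<lambda>p. \<Sum>x\<in>X. cnj (a x) * (s p * cis (of_int x * p))) has_integral
      (\<Sum>x\<in>X. cnj (a x) * (2 * pi * a x))) {-pi..pi}"
    by (intro has_integral_sum assms has_integral_mult_right inner)
  with \<open>(\<Sum>x\<in>X. cnj (a x) * (2 * pi * a x)) = 2 * pi * S\<close>
  have ss: "((\<lambda>p. s p * cnj (s p)) has_integral (2 * pi * S)) {-pi..pi}"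
    unfolding cs by (simp add: sum_distrib_left mult_ac)
  have re: "((\<lambda>p. Re (g p * cnj (s p))) has_integral (2 * pi * S)) {-pi..pi}"
     "((\<lambda>p. Re (s p * cnj (s p))) has_integral (2 * pi * S)) {-pi..pi}"
    using has_integral_linear[OF gs bounded_linear_Re] has_integral_linear[OF ss bounded_linear_Re]
    by (simp_all add: o_def)
  have "((\<lambda>p. 2 * Re (g p * cnj (s p)) - Re (s p * cnj (s p))) has_integral
      (2 * (2 * pi * S) - 2 * pi * S)) {-pi..pi}"
    by (intro has_integral_diff has_integral_mult_right re)
  moreover have "((\<lambda>p. M\<^sup>2) has_integral (2 * pi * M\<^sup>2)) {-pi..pi}"
    using has_integral_const_real[of "M\<^sup>2" "-pi" pi] by (simp add: mult.commute)
  moreover have "2 * Re (g p * cnj (s p)) - Re (s p * cnj (s p)) \<le> M\<^sup>2" if "p \<in> {-pi..pi}" for p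
  proof -
    have "0 \<le> (cmod (g p - s p))\<^sup>2" by simp
    also have "\<dots> = (cmod (g p))\<^sup>2 - 2 * Re (g p * cnj (s p)) + Re (s p * cnj (s p))"
      unfolding cmod_power2 by (simp add: power2_eq_square algebra_simps)
    also have "(cmod (g p))\<^sup>2 \<le> M\<^sup>2" using M[OF that] by (intro power_mono) auto
    finally show ?thesis by simp
  qed
  ultimately have "2 * (2 * pi * S) - 2 * pi * S \<le> 2 * pi * M\<^sup>2"
    by (rule has_integral_le)
  then have "2 * pi * S \<le> 2 * pi * M\<^sup>2" by simp
  then show ?thesis by (simp add: S_def a_def)
qed

text \<open>Conjugation combined with the reflection of \<open>p\<close> fixes the Fourier kernel,
  so the integral equals minus its own conjugate.\<close>

lemma Re_fcoef_eq_0: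
  assumes "\<And>p. cnj (g (- p)) = - g p"
  shows "Re (fcoef g x) = 0"
proof -
  have "cnj (integral {-pi..pi} (\<lambda>p. g p * cis (of_int x * p)))
      = integral {-pi..pi} (\<lambda>p. cnj (g p) * cis (of_int x * (- p)))"
    by (simp add: integral_cnj cis_cnj)
  also have "\<dots> = integral {-pi..pi} (\<lambda>p. cnj (g (- p)) * cis (of_int x * p))"
    using Henstock_Kurzweil_Integration.integral_reflect_real[of pi "-pi" "\<lambda>p. cnj (g p) * cis (of_int x * (- p))"]
    by (simp only: minus_minus)
  also have "\<dots> = - integral {-pi..pi} (\<lambda>p. g p * cis (of_int x * p))"
    by (simp add: assms)
  finally have "Re (integral {-pi..pi} (\<lambda>p. g p * cis (of_int x * p))) = 0"
    by (simp add: complex_eq_iff)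
  then show ?thesis by (simp add: fcoef_def Re_divide_of_real)
qed

text \<open>Factors \<open>cis p\<close> and \<open>cis (- p)\<close> turn into shifts of
  \<open>x\<close>. The factor \<open>* 1\<close> in the source term exposes the constant function
  1, whose coefficients form the Kronecker delta at \<open>x = 0\<close>.\<close>

lemma evol_fcoef:
  fixes G1 G2 :: "int \<Rightarrow> real \<Rightarrow> complex"
  assumes cont: "\<And>t. continuous_on {-pi..pi} (G1 t)" "\<And>t. continuous_on {-pi..pi} (G2 t)"
    and G1: "\<And>t. G1 t = (\<lambda>p. hop \<mu> \<delta> * (G1 (t-1) p * cis p - \<i> * of_real \<delta> * (G2 (t-1) p * cis p)
        + of_real \<mu> * (G2 (t-1) p + \<i> * of_real \<delta> * G1 (t-1) p)))"
    and G2: "\<And>t. G2 t = (\<lambda>p. hop \<mu> \<delta> * (G2 (t-1) p * cis (- p) + \<i> * of_real \<delta> * (G1 (t-1) p * cis (- p))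
        - of_real \<mu> * (G1 (t-1) p - \<i> * of_real \<delta> * G2 (t-1) p)) + (if t = 0 then s else 0) * 1)"
  shows "evol \<mu> \<delta> s (\<lambda>x t. fcoef (G1 t) x) (\<lambda>x t. fcoef (G2 t) x)"
  unfolding evol_def
proof (intro allI conjI)
  fix x t
  show "fcoef (G1 t) x = hop \<mu> \<delta> * (fcoef (G1 (t-1)) (x+1) - \<i> * of_real \<delta> * fcoef (G2 (t-1)) (x+1)
        + of_real \<mu> * (fcoef (G2 (t-1)) x + \<i> * of_real \<delta> * fcoef (G1 (t-1)) x))"
    by (subst G1[of t])
      (simp only: fcoef_add fcoef_diff fcoef_mult_left fcoef_cis cont continuous_intros
        continuous_on_id)
  show "fcoef (G2 t) x = hop \<mu> \<delta> * (fcoef (G2 (t-1)) (x-1) + \<i> * of_real \<delta> * fcoef (G1 (t-1)) (x-1)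
        - of_real \<mu> * (fcoef (G1 (t-1)) x - \<i> * of_real \<delta> * fcoef (G2 (t-1)) x))
        + (if x = 0 \<and> t = 0 then s else 0)"
  proof -
    have "fcoef (G2 t) x = hop \<mu> \<delta> * (fcoef (G2 (t-1)) (x-1) + \<i> * of_real \<delta> * fcoef (G1 (t-1)) (x-1)
        - of_real \<mu> * (fcoef (G1 (t-1)) x - \<i> * of_real \<delta> * fcoef (G2 (t-1)) x))
        + (if t = 0 then s else 0) * fcoef (\<lambda>_. 1) x"
      by (subst G2[of t])
        (simp only: fcoef_add fcoef_diff fcoef_mult_left fcoef_cis cont continuous_intros
        continuous_on_id)
    then show ?thesis by (simp add: fcoef_1)
  qed
qed

section \<open>Summability criteria on the two-dimensional lattice\<close>

lemma summable_on_power_nat_abs: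
  fixes r :: real
  assumes "0 \<le> r" "r < 1"
  shows "(\<lambda>t::int. r ^ nat \<bar>t\<bar>) summable_on UNIV"
proof -
  have n: "(\<lambda>n::nat. r ^ n) summable_on UNIV"
    using assms by (intro norm_summable_imp_summable_on) (simp add: summable_geometric)
  have "(\<lambda>t::int. r ^ nat \<bar>t\<bar>) summable_on {0..}"
  proof (subst summable_on_reindex_bij_betw[of int UNIV "{0..}", symmetric])
    show "bij_betw int UNIV {0..}"
      by (rule bij_betw_byWitness[where f' = nat]) auto
  qed (use n in simp)
  moreover have "(\<lambda>t::int. r ^ nat \<bar>t\<bar>) summable_on {..<0}"
  proof (subst summable_on_reindex_bij_betw[of "\<lambda>n. - int (Suc n)" UNIV "{..<0}", symmetric])
    show "bij_betw (\<lambda>n. - int (Suc n)) UNIV {..<0}"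
      by (rule bij_betw_byWitness[where f' = "\<lambda>t. nat (- t - 1)"]) auto
  qed (use summable_on_cmult_right[OF n, of r] in \<open>simp add: nat_add_distrib\<close>)
  ultimately have "(\<lambda>t::int. r ^ nat \<bar>t\<bar>) summable_on ({0..} \<union> {..<0})"
    by (rule summable_on_Un_disjoint) auto
  moreover have "{0..} \<union> {..<0} = (UNIV :: int set)" by auto
  ultimately show ?thesis by simp
qed

text \<open>A finite set of pairs lies in a finite rectangle, which is summed row by row. The
  hypothesis on rows has the form that Bessel's inequality delivers at a fixed time.\<close>

lemma summable_on_prod_le:
  fixes h :: "int \<Rightarrow> int \<Rightarrow> real"
  assumes "\<And>x t. h x t \<ge> 0" "\<And>t X. finite X \<Longrightarrow> (\<Sum>x\<in>X. h x t) \<le> b t" "b summable_on UNIV"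
  shows "(\<lambda>(x, t). h x t) summable_on UNIV"
proof (rule nonneg_bdd_above_summable_on)
  have b: "b t \<ge> 0" for t using assms(2)[of "{}" t] by simp
  show "bdd_above (sum (\<lambda>(x, t). h x t) ` {F. F \<subseteq> UNIV \<and> finite F})"
  proof (rule bdd_aboveI2)
    fix F :: "(int \<times> int) set"
    assume "F \<in> {F. F \<subseteq> UNIV \<and> finite F}"
    then have F: "finite F" by simp
    have "(\<Sum>(x, t)\<in>F. h x t) \<le> (\<Sum>(x, t)\<in>fst ` F \<times> snd ` F. h x t)"
      by (rule sum_mono2) (use F assms(1) in \<open>force+\<close>)
    also have "\<dots> = (\<Sum>t\<in>snd ` F. \<Sum>x\<in>fst ` F. h x t)"
      unfolding sum.cartesian_product[symmetric] by (rule sum.swap)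
    also have "\<dots> \<le> (\<Sum>t\<in>snd ` F. b t)"
      by (intro sum_mono assms(2)) (use F in simp)
    also have "\<dots> \<le> (\<Sum>\<^sub>\<infinity>t. b t)"
      by (rule finite_sum_le_infsum) (use F b assms(3) in auto)
    finally show "(\<Sum>(x, t)\<in>F. h x t) \<le> (\<Sum>\<^sub>\<infinity>t. b t)" .
  qed
qed (use assms(1) in auto)

section \<open>The solution by Fourier modes\<close>

text \<open>Half the trace of the one-step matrix on the mode \<open>p\<close>; the eigenvalues
  \<open>l\<close> are the solutions of l + 1/l = 2 \<open>disp\<close>.\<close>

definition disp :: "real \<Rightarrow> real \<Rightarrow> real \<Rightarrow> complex" where
  "disp \<mu> \<delta> p = hop \<mu> \<delta> * (of_real (cos p) + \<i> * of_real (\<mu> * \<delta>))"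

text \<open>The principal branch has nonnegative real part. This choice decides which of the two
  eigenvalues \<open>eig\<close> denotes, and for \<delta> > 0 makes it the one inside the unit
  circle.\<close>

definition droot :: "real \<Rightarrow> real \<Rightarrow> real \<Rightarrow> complex" where
  "droot \<mu> \<delta> p = csqrt (1 - (disp \<mu> \<delta> p)\<^sup>2)"

definition eig :: "real \<Rightarrow> real \<Rightarrow> real \<Rightarrow> complex" where
  "eig \<mu> \<delta> p = disp \<mu> \<delta> p - \<i> * droot \<mu> \<delta> p"

text \<open>The two components of the spectral projection of the source \<open>(0, 2)\<close> to the \<open>\<lambda>\<close>-eigenspace for \<open>t \<ge> 0\<close>,
  and of minus its projection to the \<open>1/\<lambda>\<close>-eigenspace for \<open>t < 0\<close>, times \<open>\<lambda>\<close> to the power \<open>\<bar>t\<bar>\<close>.\<close>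

definition mode1 :: "real \<Rightarrow> real \<Rightarrow> int \<Rightarrow> real \<Rightarrow> complex" where
  "mode1 \<mu> \<delta> t p = eig \<mu> \<delta> p ^ nat \<bar>t\<bar> *
     (hop \<mu> \<delta> * (\<i> * of_real \<mu> + of_real \<delta> * cis p) / droot \<mu> \<delta> p)"

definition mode2 :: "real \<Rightarrow> real \<Rightarrow> int \<Rightarrow> real \<Rightarrow> complex" where
  "mode2 \<mu> \<delta> t p = eig \<mu> \<delta> p ^ nat \<bar>t\<bar> *
     ((if t < 0 then -1 else 1) + hop \<mu> \<delta> * of_real (sin p) / droot \<mu> \<delta> p)"

text \<open>The letters stand for \<open>hop\<close>, \<mu>, \<delta>, cos p, sin p,
  \<open>droot\<close> and \<open>disp\<close>, and the left sides are one step M of the evolution.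
  With l = \<tau> - i q and 1/l = \<tau> + i q, the vector \<open>(w1, w2)\<close> is (M - 1/l) (0,
  2) / (l - 1/l), so it is an eigenvector by Cayley-Hamilton. Only the square of \<open>q\<close> is
  prescribed, so the lemma also applies to \<open>- q\<close>, which exchanges the
  eigenvalues.\<close>

lemma eigenvector_identities:
  fixes C u d K S q \<tau> :: complex
  assumes "q \<noteq> 0" and \<tau>: "\<tau> = C * (K + \<i> * (u * d))" and q: "q\<^sup>2 = 1 - \<tau>\<^sup>2" and KS: "K\<^sup>2 + S\<^sup>2 = 1"
    and C: "C * (C * ((1 + u\<^sup>2) * (1 - d\<^sup>2))) = 1"
    and w1: "w1 = C * (\<i> * u + d * (K + \<i> * S)) / q" and w2: "w2 = 1 + C * S / q"
  shows "C * (w1 * (K + \<i> * S) - \<i> * d * (w2 * (K + \<i> * S)) + u * (w2 + \<i> * d * w1))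
           = (\<tau> - \<i> * q) * w1" (is "?a = _")
    and "C * (w2 * (K - \<i> * S) + \<i> * d * (w1 * (K - \<i> * S)) - u * (w1 - \<i> * d * w2))
           = (\<tau> - \<i> * q) * w2" (is "?b = _")
proof -
  define v1 where "v1 = C * (\<i> * u + d * (K + \<i> * S))"
  define v2 where "v2 = q + C * S"
  have w: "w1 = v1 / q" "w2 = v2 / q"
    using \<open>q \<noteq> 0\<close> by (simp_all add: w1 w2 v1_def v2_def field_simps)
  have "C * (v1 * (K + \<i> * S) - \<i> * d * (v2 * (K + \<i> * S)) + u * (v2 + \<i> * d * v1)) = (\<tau> - \<i> * q) * v1"
    unfolding v1_def v2_def \<tau> by (simp add: algebra_simps)
  moreover have "?a = C * (v1 * (K + \<i> * S) - \<i> * d * (v2 * (K + \<i> * S)) + u * (v2 + \<i> * d * v1)) / q"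
    unfolding w using \<open>q \<noteq> 0\<close> by (simp add: field_simps)
  ultimately show "?a = (\<tau> - \<i> * q) * w1" by (simp add: w)
  \<comment> \<open>Unlike the first component, this one is not an identity in free variables: the
    difference is exhibited as a combination of the three constraints on \<open>q\<close>,
    \<open>C\<close> and \<open>K\<close>, \<open>S\<close>.\<close>
  have "(\<tau> - \<i> * q) * v2 - C * (v2 * (K - \<i> * S) + \<i> * d * (v1 * (K - \<i> * S)) - u * (v1 - \<i> * d * v2))
     = - \<i> * (q\<^sup>2 - (1 - \<tau>\<^sup>2)) - \<i> * (1 - C * (C * ((1 + u\<^sup>2) * (1 - d\<^sup>2))))
       + \<i> * C\<^sup>2 * (1 - d\<^sup>2) * (K\<^sup>2 + S\<^sup>2 - 1)"
    unfolding v1_def v2_def \<tau> by (simp add: algebra_simps power2_eq_square)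
  also have "\<dots> = 0" unfolding q KS C by simp
  finally have "C * (v2 * (K - \<i> * S) + \<i> * d * (v1 * (K - \<i> * S)) - u * (v1 - \<i> * d * v2)) = (\<tau> - \<i> * q) * v2"
    by simp
  moreover have "?b = C * (v2 * (K - \<i> * S) + \<i> * d * (v1 * (K - \<i> * S)) - u * (v1 - \<i> * d * v2)) / q"
    unfolding w using \<open>q \<noteq> 0\<close> by (simp add: field_simps)
  ultimately show "?b = (\<tau> - \<i> * q) * w2" by (simp add: w)
qed

lemma hop_bounds:
  assumes "\<mu> > 0" "0 \<le> \<delta>" "\<delta> < 1"
  shows "Im (hop \<mu> \<delta>) = 0" "Re (hop \<mu> \<delta>) > 0"
proof -
  have "\<delta>\<^sup>2 < 1" using assms by (simp add: abs_square_less_1)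
  moreover have "1 + \<mu>\<^sup>2 > 0" by (simp add: add_pos_nonneg)
  ultimately show "Im (hop \<mu> \<delta>) = 0" "Re (hop \<mu> \<delta>) > 0"
    by (simp_all add: hop_def)
qed

text \<open>Keeps the discriminant off the branch cut of \<open>csqrt\<close>, so that
  \<open>droot\<close> is continuous and nonzero. The imaginary part is a multiple of \<delta> cos
  p. If cos p = 0, the real part is at least 1; if \<delta> = 0, it is positive because \<mu> > 0
  makes \<open>hop\<close> less than 1.\<close>

lemma disc_notin_nonpos_Reals:
  assumes "\<mu> > 0" "0 \<le> \<delta>" "\<delta> < 1"
  shows "1 - (disp \<mu> \<delta> p)\<^sup>2 \<notin> \<real>\<^sub>\<le>\<^sub>0"
proof
  define c where "c = Re (hop \<mu> \<delta>)"
  have c: "hop \<mu> \<delta> = of_real c" "c > 0"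
    using hop_bounds[OF assms] by (simp_all add: c_def complex_eq_iff)
  have re: "Re (1 - (disp \<mu> \<delta> p)\<^sup>2) = 1 - c\<^sup>2 * ((cos p)\<^sup>2 - (\<mu> * \<delta>)\<^sup>2)"
    and im: "Im (1 - (disp \<mu> \<delta> p)\<^sup>2) = - 2 * c\<^sup>2 * (\<mu> * \<delta>) * cos p"
    by (simp_all add: disp_def c power2_eq_square algebra_simps)
  assume "1 - (disp \<mu> \<delta> p)\<^sup>2 \<in> \<real>\<^sub>\<le>\<^sub>0"
  then have le: "1 - c\<^sup>2 * ((cos p)\<^sup>2 - (\<mu> * \<delta>)\<^sup>2) \<le> 0" and "\<delta> = 0 \<or> cos p = 0"
    using im re c assms unfolding complex_nonpos_Reals_iff by auto
  then consider "\<delta> = 0" | "cos p = 0" by blast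
  then show False
  proof cases
    case 1
    have "1 + \<mu>\<^sup>2 > 1" using assms by simp
    moreover from this have "c\<^sup>2 * (1 + \<mu>\<^sup>2) = 1"
      using c 1 unfolding hop_def of_real_eq_iff by (auto simp: power_divide)
    ultimately have "c\<^sup>2 < 1" using c
      by (metis mult.commute mult_less_cancel_right_pos mult_1 zero_less_power less_numeral_extra(1) order.strict_trans mult.right_neutral)
    then have "c\<^sup>2 * (cos p)\<^sup>2 < 1"
      by (metis abs_cos_le_one abs_square_le_1 mult_left_le order.strict_trans1 zero_le_power2)
    with le 1 show False by simp
  next
    case 2
    have "c\<^sup>2 * (\<mu> * \<delta>)\<^sup>2 \<ge> 0" by simp
    with le 2 show False by simp
  qed
qed

lemma droot_facts:
  assumes "\<mu> > 0" "0 \<le> \<delta>" "\<delta> < 1"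
  shows "droot \<mu> \<delta> p \<noteq> 0" "Re (droot \<mu> \<delta> p) > 0" "(droot \<mu> \<delta> p)\<^sup>2 = 1 - (disp \<mu> \<delta> p)\<^sup>2"
    and "eig \<mu> \<delta> p * (disp \<mu> \<delta> p + \<i> * droot \<mu> \<delta> p) = 1"
proof -
  note n = disc_notin_nonpos_Reals[OF assms, of p]
  then show *: "droot \<mu> \<delta> p \<noteq> 0" by (auto simp: droot_def)
  show sq: "(droot \<mu> \<delta> p)\<^sup>2 = 1 - (disp \<mu> \<delta> p)\<^sup>2" by (simp add: droot_def)
  have "Re (droot \<mu> \<delta> p) \<noteq> 0"
  proof
    assume "Re (droot \<mu> \<delta> p) = 0"
    then have "(droot \<mu> \<delta> p)\<^sup>2 \<in> \<real>\<^sub>\<le>\<^sub>0"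
      by (simp add: complex_nonpos_Reals_iff power2_eq_square)
    with n sq show False by simp
  qed
  moreover have "Re (droot \<mu> \<delta> p) \<ge> 0" unfolding droot_def by (rule Re_csqrt)
  ultimately show "Re (droot \<mu> \<delta> p) > 0" by simp
  have "eig \<mu> \<delta> p * (disp \<mu> \<delta> p + \<i> * droot \<mu> \<delta> p) = (disp \<mu> \<delta> p)\<^sup>2 + (droot \<mu> \<delta> p)\<^sup>2"
    by (simp add: eig_def algebra_simps power2_eq_square)
  then show "eig \<mu> \<delta> p * (disp \<mu> \<delta> p + \<i> * droot \<mu> \<delta> p) = 1" by (simp add: sq)
qed

text \<open>Writing \<open>\<lambda>\<close> for the eigenvalue, \<open>\<lambda> + 1/\<lambda> = 2 \<tau>\<close> has positive imaginary part and
  \<open>\<lambda> - 1/\<lambda> = - 2 \<i> q\<close> has negative imaginary part.\<close>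

lemma norm_eig_less_1:
  assumes "\<mu> > 0" "0 < \<delta>" "\<delta> < 1"
  shows "cmod (eig \<mu> \<delta> p) < 1"
proof -
  have a: "0 \<le> \<delta>" using assms by simp
  note q = droot_facts[OF assms(1) a assms(3), of p]
  define l where "l = eig \<mu> \<delta> p"
  define N where "N = (cmod l)\<^sup>2"
  have "l \<noteq> 0" using q(4) by (auto simp: l_def)
  then have N: "N > 0" by (simp add: N_def)
  have inv: "inverse l = disp \<mu> \<delta> p + \<i> * droot \<mu> \<delta> p"
    using q(4) by (simp add: l_def inverse_unique)
  \<comment> \<open>Hence the two sign conditions read Im l (1 + 1/N) < 0 and Im l (1 - 1/N) > 0.
    The first gives Im l < 0, and then the second gives N < 1.\<close>
  have iv: "Im (inverse l) = - Im l / N"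
    by (simp add: N_def cmod_power2)
  have "Im l - Im (inverse l) = - 2 * Re (droot \<mu> \<delta> p)"
    unfolding inv by (simp add: l_def eig_def)
  then have "Im l * (1 + 1 / N) < 0"
    using q(2) unfolding iv by (simp add: algebra_simps)
  then have il: "Im l < 0"
    using N by (simp add: mult_less_0_iff add_pos_pos not_less)
      (smt (verit) divide_nonneg_pos zero_less_divide_1_iff)
  have "Im l + Im (inverse l) = 2 * Im (disp \<mu> \<delta> p)"
    unfolding inv by (simp add: l_def eig_def)
  moreover have "Im (disp \<mu> \<delta> p) > 0"
    using hop_bounds[OF assms(1) a assms(3)] assms by (simp add: disp_def)
  ultimately have "Im l * (1 - 1 / N) > 0"
    unfolding iv by (simp add: algebra_simps)
  then have "1 - 1 / N < 0" using il by (simp add: zero_less_mult_iff)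
  then have "N < 1" using N by (simp add: field_simps)
  then show ?thesis unfolding N_def l_def by (simp add: abs_square_less_1)
qed

section \<open>Continuity of the modes and passage to the limit\<close>

lemma continuous_on_disp:
  "continuous_on ({0..<1} \<times> UNIV) (\<lambda>z. hop \<mu> (fst z))" "continuous_on ({0..<1} \<times> UNIV) (\<lambda>z. disp \<mu> (fst z) (snd z))"
proof -
  have nz: "sqrt (1 + \<mu>\<^sup>2) * sqrt (1 - (fst z)\<^sup>2) \<noteq> 0" if "z \<in> {0..<1} \<times> UNIV" for z :: "real \<times> real"
  proof -
    have "(fst z)\<^sup>2 < 1" using that by (auto simp: abs_square_less_1)
    moreover have "1 + \<mu>\<^sup>2 > 0" by (simp add: add_pos_nonneg)
    ultimately show ?thesis by simp
  qed
  show 1: "continuous_on ({0..<1} \<times> UNIV) (\<lambda>z. hop \<mu> (fst z))"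
    unfolding hop_def using nz by (intro continuous_intros) auto
  then show "continuous_on ({0..<1} \<times> UNIV) (\<lambda>z. disp \<mu> (fst z) (snd z))"
    unfolding disp_def by (intro continuous_intros)
qed

text \<open>Continuity is joint in \<delta> and \<open>p\<close> and includes \<delta> = 0, which is
  what allows the limit to pass under the Fourier integral.\<close>

lemma continuous_on_modes:
  assumes "\<mu> > 0"
  shows "continuous_on ({0..<1} \<times> UNIV) (\<lambda>z. eig \<mu> (fst z) (snd z))"
    and "continuous_on ({0..<1} \<times> UNIV) (\<lambda>z. mode1 \<mu> (fst z) t (snd z))"
    and "continuous_on ({0..<1} \<times> UNIV) (\<lambda>z. mode2 \<mu> (fst z) t (snd z))"
proof -
  note d = continuous_on_disp[of \<mu>]
  have q: "continuous_on ({0..<1} \<times> UNIV) (\<lambda>z. droot \<mu> (fst z) (snd z))"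
    unfolding droot_def
    by (rule continuous_on_compose2[OF continuous_on_csqrt])
      (use disc_notin_nonpos_Reals[OF assms] in \<open>auto intro!: continuous_intros d\<close>)
  show e: "continuous_on ({0..<1} \<times> UNIV) (\<lambda>z. eig \<mu> (fst z) (snd z))"
    unfolding eig_def by (intro continuous_intros d q)
  have nz: "\<forall>z\<in>{0..<1} \<times> UNIV. droot \<mu> (fst z) (snd z) \<noteq> 0"
    using droot_facts(1)[OF assms] by auto
  show "continuous_on ({0..<1} \<times> UNIV) (\<lambda>z. mode1 \<mu> (fst z) t (snd z))"
    unfolding mode1_def by (intro continuous_intros d q e nz)
  show "continuous_on ({0..<1} \<times> UNIV) (\<lambda>z. mode2 \<mu> (fst z) t (snd z))"
    unfolding mode2_def by (intro continuous_intros d q e nz)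
qed

lemma continuous_on_modes':
  assumes "\<mu> > 0" "0 \<le> \<delta>" "\<delta> < 1"
  shows "continuous_on A (eig \<mu> \<delta>)" "continuous_on A (mode1 \<mu> \<delta> t)" "continuous_on A (mode2 \<mu> \<delta> t)"
proof -
  have "continuous_on A (\<lambda>p. (\<delta>, p))" "(\<lambda>p. (\<delta>, p)) ` A \<subseteq> {0..<1} \<times> UNIV"
    using assms by (auto intro!: continuous_intros)
  note compose = continuous_on_compose2[OF _ this]
  show "continuous_on A (eig \<mu> \<delta>)" "continuous_on A (mode1 \<mu> \<delta> t)" "continuous_on A (mode2 \<mu> \<delta> t)"
    using compose[OF continuous_on_modes(1)[OF assms(1)]] compose[OF continuous_on_modes(2)[OF assms(1)]]
      compose[OF continuous_on_modes(3)[OF assms(1)]] by simp_all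
qed

lemma continuous_on_fcoef_param:
  assumes "continuous_on (U \<times> UNIV) (\<lambda>z. g (fst z) (snd z))"
  shows "continuous_on U (\<lambda>\<delta>. fcoef (g \<delta>) x)"
proof -
  have "continuous_on U (\<lambda>\<delta>. integral (cbox (-pi) pi) (\<lambda>p. g \<delta> p * cis (of_int x * p)))"
    by (rule integral_continuous_on_param)
      (auto simp: case_prod_unfold intro!: continuous_intros continuous_on_subset[OF assms])
  then show ?thesis unfolding fcoef_def by (intro continuous_intros) simp_all
qed

definition sol1 :: "real \<Rightarrow> real \<Rightarrow> int \<Rightarrow> int \<Rightarrow> complex" where
  "sol1 \<mu> \<delta> x t = fcoef (mode1 \<mu> \<delta> t) x"

definition sol2 :: "real \<Rightarrow> real \<Rightarrow> int \<Rightarrow> int \<Rightarrow> complex" where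
  "sol2 \<mu> \<delta> x t = fcoef (mode2 \<mu> \<delta> t) x"

lemma tendsto_sol:
  assumes "\<mu> > 0"
  shows "((\<lambda>\<delta>. sol1 \<mu> \<delta> x t) \<longlongrightarrow> sol1 \<mu> 0 x t) (at_right 0)"
    and "((\<lambda>\<delta>. sol2 \<mu> \<delta> x t) \<longlongrightarrow> sol2 \<mu> 0 x t) (at_right 0)"
proof -
  have "((\<lambda>\<delta>. fcoef (g \<delta>) x) \<longlongrightarrow> fcoef (g 0) x) (at_right 0)"
    if "continuous_on ({0..<1} \<times> UNIV) (\<lambda>z. g (fst z) (snd z))"
    for g :: "real \<Rightarrow> real \<Rightarrow> complex"
  proof -
    have "((\<lambda>\<delta>. fcoef (g \<delta>) x) \<longlongrightarrow> fcoef (g 0) x) (at 0 within {0..<1})"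
      using continuous_on_fcoef_param[OF that, of x] unfolding continuous_on_def by (rule bspec) simp
    then have "((\<lambda>\<delta>. fcoef (g \<delta>) x) \<longlongrightarrow> fcoef (g 0) x) (at 0 within {0<..<1})"
      by (rule tendsto_within_subset) auto
    moreover have "at 0 within {0<..<1} = at_right (0::real)"
      by (rule at_within_nhd[of _ "{-1<..<1}"]) auto
    ultimately show ?thesis by simp
  qed
  from this[OF continuous_on_modes(2)[OF assms]] this[OF continuous_on_modes(3)[OF assms]]
  show "((\<lambda>\<delta>. sol1 \<mu> \<delta> x t) \<longlongrightarrow> sol1 \<mu> 0 x t) (at_right 0)"
    and "((\<lambda>\<delta>. sol2 \<mu> \<delta> x t) \<longlongrightarrow> sol2 \<mu> 0 x t) (at_right 0)"
    by (simp_all add: sol1_def sol2_def)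
qed

text \<open>On each mode the solution multiplies by \<open>eig\<close> per step along one
  eigenvector for nonnegative times, and by the inverse of \<open>eig\<close> along the other for
  negative times. The two eigenvectors differ by (0, 2), and this jump at t = 0 is the
  source.\<close>

lemma evol_sol:
  assumes "\<mu> > 0" "0 \<le> \<delta>" "\<delta> < 1"
  shows "evol \<mu> \<delta> 2 (sol1 \<mu> \<delta>) (sol2 \<mu> \<delta>)"
proof -
  define G1 where "G1 = mode1 \<mu> \<delta>"
  define G2 where "G2 = mode2 \<mu> \<delta>"
  define d where "d = complex_of_real \<delta>"
  define u where "u = complex_of_real \<mu>"
  define C where "C = hop \<mu> \<delta>"
  have steps: "G1 t p = C * (G1 (t-1) p * cis p - \<i> * d * (G2 (t-1) p * cis p)
        + u * (G2 (t-1) p + \<i> * d * G1 (t-1) p))" (is ?A)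
     "G2 t p = C * (G2 (t-1) p * cis (- p) + \<i> * d * (G1 (t-1) p * cis (- p))
        - u * (G1 (t-1) p - \<i> * d * G2 (t-1) p)) + (if t = 0 then 2 else 0) * 1" (is ?B) for t p
  proof -
    define K where "K = complex_of_real (cos p)"
    define S where "S = complex_of_real (sin p)"
    define q where "q = droot \<mu> \<delta> p"
    define \<tau> where "\<tau> = disp \<mu> \<delta> p"
    define l where "l = eig \<mu> \<delta> p"
    have cis: "cis p = K + \<i> * S" "cis (- p) = K - \<i> * S"
      by (simp_all add: K_def S_def complex_eq_iff)
    define U1 where "U1 a b = C * (a * (K + \<i> * S) - \<i> * d * (b * (K + \<i> * S)) + u * (b + \<i> * d * a))" for a b
    define U2 where "U2 a b = C * (b * (K - \<i> * S) + \<i> * d * (a * (K - \<i> * S)) - u * (a - \<i> * d * b))" for a b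
    have lin: "U1 (r * a) (r * b) = r * U1 a b" "U2 (r * a) (r * b) = r * U2 a b" for r a b
      unfolding U1_def U2_def by (simp_all add: algebra_simps)
    define w1 where "w1 = C * (\<i> * u + d * (K + \<i> * S)) / q"
    define w2 where "w2 = 1 + C * S / q"
    \<comment> \<open>The second component of the eigenvector for 1/l; the first component
      \<open>w1\<close> is shared with the eigenvector for l, and
      \<open>w2 - w3 = 2\<close>.\<close>
    define w3 where "w3 = - 1 + C * S / q"
    have q: "q \<noteq> 0" "q\<^sup>2 = 1 - \<tau>\<^sup>2" and l: "l * (\<tau> + \<i> * q) = 1" "l = \<tau> - \<i> * q"
      using droot_facts[OF assms, of p] by (simp_all add: q_def \<tau>_def l_def eig_def)
    have \<tau>: "\<tau> = C * (K + \<i> * (u * d))"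
      by (simp add: \<tau>_def disp_def K_def C_def u_def d_def)
    have KS: "K\<^sup>2 + S\<^sup>2 = 1"
      unfolding K_def S_def of_real_power[symmetric] of_real_add[symmetric] by simp
    have C: "C * (C * ((1 + u\<^sup>2) * (1 - d\<^sup>2))) = 1"
      unfolding C_def u_def d_def by (rule hop_square) (use assms in simp)
    have pos: "U1 w1 w2 = l * w1" "U2 w1 w2 = l * w2"
      unfolding U1_def U2_def l(2)
      by (rule eigenvector_identities[OF q(1) \<tau> q(2) KS C w1_def w2_def])+
    \<comment> \<open>Replacing \<open>q\<close> by \<open>- q\<close> turns \<open>(w1, w2)\<close>
      into \<open>(- w1, - w3)\<close> and l into 1/l.\<close>
    have "U1 (- w1) (- w3) = (\<tau> - \<i> * (- q)) * (- w1)" "U2 (- w1) (- w3) = (\<tau> - \<i> * (- q)) * (- w3)"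
      unfolding U1_def U2_def
      by (rule eigenvector_identities[of "- q" \<tau> C K u d S]; use q \<tau> KS C in \<open>simp add: w1_def w3_def\<close>)+
    with lin[of "-1" w1 w3] have "U1 w1 w3 = (\<tau> + \<i> * q) * w1" "U2 w1 w3 = (\<tau> + \<i> * q) * w3"
      by simp_all
    then have neg: "U1 (l * w1) (l * w3) = w1" "U2 (l * w1) (l * w3) = w3"
      unfolding lin by (simp_all add: l(1) mult.assoc[symmetric])
    have G: "G1 t p = l ^ nat \<bar>t\<bar> * w1" "G2 t p = l ^ nat \<bar>t\<bar> * (if t < 0 then w3 else w2)" for t
      by (simp_all add: G1_def G2_def mode1_def mode2_def l_def w1_def w2_def w3_def C_def u_def d_def
          q_def S_def[symmetric] cis(1))
    have goal: "G1 t p = U1 (G1 (t-1) p) (G2 (t-1) p) \<and>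
      G2 t p = U2 (G1 (t-1) p) (G2 (t-1) p) + (if t = 0 then 2 else 0)"
    proof -
      consider "t > 0" | "t = 0" | "t < 0" by linarith
      then show ?thesis
      proof cases
        case 1
        then have "nat \<bar>t\<bar> = Suc (nat \<bar>t - 1\<bar>)" by simp
        with 1 show ?thesis unfolding G by (simp add: lin pos)
      next
        case 2
        \<comment> \<open>The value at time -1 is l times \<open>(w1, w3)\<close>; one step makes it
          \<open>(w1, w3)\<close>, and the source 2 raises \<open>w3\<close> to
          \<open>w2\<close>.\<close>
        then show ?thesis unfolding G by (simp add: neg) (simp add: w2_def w3_def)
      next
        case 3
        then have "nat \<bar>t - 1\<bar> = Suc (nat \<bar>t\<bar>)" by simp
        with 3 have prev: "G1 (t-1) p = l ^ nat \<bar>t\<bar> * (l * w1)" "G2 (t-1) p = l ^ nat \<bar>t\<bar> * (l * w3)"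
          unfolding G by (simp_all only: power_Suc mult_ac) simp
        show ?thesis
          unfolding prev G(1,2)[of t] lin(1)[of "l ^ nat \<bar>t\<bar>" "l * w1" "l * w3"]
            lin(2)[of "l ^ nat \<bar>t\<bar>" "l * w1" "l * w3"] neg using 3 by simp
      qed
    qed
    then show ?A ?B unfolding U1_def U2_def cis by simp_all
  qed
  have "evol \<mu> \<delta> 2 (\<lambda>x t. fcoef (G1 t) x) (\<lambda>x t. fcoef (G2 t) x)"
  proof (rule evol_fcoef)
    show "continuous_on {-pi..pi} (G1 t)" "continuous_on {-pi..pi} (G2 t)" for t
      unfolding G1_def G2_def by (rule continuous_on_modes'[OF assms])+
  qed (rule ext, rule steps[unfolded C_def d_def u_def])+
  moreover have "(\<lambda>x t. fcoef (G1 t) x) = sol1 \<mu> \<delta>" "(\<lambda>x t. fcoef (G2 t) x) = sol2 \<mu> \<delta>"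
    by (simp_all add: fun_eq_iff G1_def G2_def sol1_def sol2_def)
  ultimately show ?thesis by simp
qed

text \<open>By compactness the modulus of \<open>eig\<close> has a maximum r < 1 over
  \<open>p\<close>, so the modes at time \<open>t\<close> are bounded by a constant times r to the
  power of the absolute value of \<open>t\<close>. Bessel's inequality turns this into a geometric
  bound on the rows.\<close>

lemma sol_square_summable:
  assumes "\<mu> > 0" "0 < \<delta>" "\<delta> < 1"
  shows "(\<lambda>(x, t). (cmod (sol1 \<mu> \<delta> x t))\<^sup>2 + (cmod (sol2 \<mu> \<delta> x t))\<^sup>2) summable_on UNIV"
proof -
  have "0 \<le> \<delta>" using assms by simp
  note cont = continuous_on_modes'[OF assms(1) this assms(3)]
  obtain p0 where p0: "\<And>p. p \<in> {-pi..pi} \<Longrightarrow> cmod (eig \<mu> \<delta> p) \<le> cmod (eig \<mu> \<delta> p0)"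
    using continuous_attains_sup[of "{-pi..pi}" "\<lambda>p. cmod (eig \<mu> \<delta> p)"]
    by (force intro!: continuous_intros cont)
  define r where "r = cmod (eig \<mu> \<delta> p0)"
  have r: "0 \<le> r" "r < 1" unfolding r_def using norm_eig_less_1[OF assms] by simp_all
  have bound: "(\<lambda>(x, t). (cmod (fcoef (G t) x))\<^sup>2) summable_on UNIV"
    if G: "\<And>t. continuous_on {-pi..pi} (G t)"
      and GM: "\<And>t p. p \<in> {-pi..pi} \<Longrightarrow> cmod (G t p) \<le> cmod (eig \<mu> \<delta> p) ^ nat \<bar>t\<bar> * M" and "M \<ge> 0"
    for G M
  proof (rule summable_on_prod_le)
    fix t :: int and X :: "int set" assume "finite X"
    have "cmod (G t p) \<le> r ^ nat \<bar>t\<bar> * M" if "p \<in> {-pi..pi}" for p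
      using GM[OF that, of t] p0[OF that] \<open>M \<ge> 0\<close> unfolding r_def
      by (meson mult_right_mono norm_ge_zero order.trans power_mono)
    from fcoef_bessel[OF G this \<open>finite X\<close>]
    show "(\<Sum>x\<in>X. (cmod (fcoef (G t) x))\<^sup>2) \<le> M\<^sup>2 * (r\<^sup>2) ^ nat \<bar>t\<bar>"
      by (simp add: power_mult_distrib power_mult[symmetric] mult.commute)
  next
    show "(\<lambda>t::int. M\<^sup>2 * (r\<^sup>2) ^ nat \<bar>t\<bar>) summable_on UNIV"
      by (intro summable_on_cmult_right summable_on_power_nat_abs)
        (use r in \<open>auto simp: abs_square_less_1\<close>)
  qed auto
  have 1: "eig \<mu> \<delta> p ^ nat \<bar>t\<bar> * mode1 \<mu> \<delta> 0 p = mode1 \<mu> \<delta> t p" for t p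
    by (simp add: mode1_def)
  \<comment> \<open>For negative \<open>t\<close> the constant 1 in \<open>mode2\<close> becomes -1,
    hence the correction by 2 and the bound \<open>M2 + 2\<close> below.\<close>
  have 2: "mode2 \<mu> \<delta> t p = eig \<mu> \<delta> p ^ nat \<bar>t\<bar> * (mode2 \<mu> \<delta> 0 p - (if t < 0 then 2 else 0))" for t p
    by (simp add: mode2_def algebra_simps)
  have "bounded (mode1 \<mu> \<delta> 0 ` {-pi..pi})" "bounded (mode2 \<mu> \<delta> 0 ` {-pi..pi})"
    by (intro compact_imp_bounded compact_continuous_image cont compact_Icc)+
  then obtain M1 M2 where M: "\<And>p. p \<in> {-pi..pi} \<Longrightarrow> cmod (mode1 \<mu> \<delta> 0 p) \<le> M1"
     "\<And>p. p \<in> {-pi..pi} \<Longrightarrow> cmod (mode2 \<mu> \<delta> 0 p) \<le> M2"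
    unfolding bounded_iff by (force simp del: atLeastAtMost_iff)
  have M0: "M1 \<ge> 0" "M2 \<ge> 0"
    by (rule order.trans[OF norm_ge_zero M(1)[of 0]] order.trans[OF norm_ge_zero M(2)[of 0]]; simp)+
  have "(\<lambda>(x, t). (cmod (fcoef (mode1 \<mu> \<delta> t) x))\<^sup>2) summable_on UNIV"
  proof (rule bound[OF cont(2) _ M0(1)])
    fix t :: int and p assume p: "p \<in> {-pi..pi}"
    show "cmod (mode1 \<mu> \<delta> t p) \<le> cmod (eig \<mu> \<delta> p) ^ nat \<bar>t\<bar> * M1"
      unfolding 1[of p t, symmetric] norm_mult norm_power
      by (intro mult_left_mono M p) simp
  qed
  moreover have "(\<lambda>(x, t). (cmod (fcoef (mode2 \<mu> \<delta> t) x))\<^sup>2) summable_on UNIV"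
  proof (rule bound[OF cont(3), where M = "M2 + 2"])
    fix t :: int and p assume p: "p \<in> {-pi..pi}"
    have "cmod (mode2 \<mu> \<delta> 0 p - (if t < 0 then 2 else 0)) \<le> M2 + 2"
      using norm_triangle_ineq4[of "mode2 \<mu> \<delta> 0 p" "if t < 0 then 2 else 0"] M(2)[OF p]
      by (auto split: if_splits)
    then show "cmod (mode2 \<mu> \<delta> t p) \<le> cmod (eig \<mu> \<delta> p) ^ nat \<bar>t\<bar> * (M2 + 2)"
      unfolding 2[of t p] norm_mult norm_power
      by (intro mult_left_mono) simp_all
  qed (use M0 in simp)
  ultimately show ?thesis
    unfolding sol1_def sol2_def case_prod_unfold by (intro summable_on_add)
qed

text \<open>At \<delta> = 0 the root \<open>droot\<close> is real and even in \<open>p\<close>. So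
  \<open>mode1\<close> at time 0 is imaginary and even, and \<open>mode2\<close> at time 0 is 1 plus
  a real odd function. Apart from the 1, both change sign under conjugation with reflection and
  contribute only imaginary values.\<close>

lemma Re_sol_initial:
  assumes "\<mu> > 0"
  shows "Re (sol1 \<mu> 0 x 0) = 0" "Re (sol2 \<mu> 0 x 0) = (if x = 0 then 1 else 0)"
proof -
  have real_even: "\<exists>r. droot \<mu> 0 p = complex_of_real r \<and> droot \<mu> 0 (- p) = complex_of_real r" for p
  proof -
    define c where "c = Re (hop \<mu> 0)"
    have c: "hop \<mu> 0 = of_real c"
      using hop_bounds[OF assms, of 0] by (simp add: c_def complex_eq_iff)
    define y where "y = 1 - (c * cos p)\<^sup>2"
    have y: "1 - (disp \<mu> 0 p)\<^sup>2 = of_real y" and e: "disp \<mu> 0 (- p) = disp \<mu> 0 p"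
      by (simp_all add: disp_def c y_def power_mult_distrib)
    have "y \<ge> 0"
      using disc_notin_nonpos_Reals[OF assms, of 0 p] by (simp add: y complex_nonpos_Reals_iff)
    then have "droot \<mu> 0 p = of_real (sqrt y)"
      unfolding droot_def y by (rule of_real_sqrt[symmetric])
    then show ?thesis using e by (auto simp: droot_def)
  qed
  have even: "droot \<mu> 0 (- p) = droot \<mu> 0 p" and real: "cnj (droot \<mu> 0 p) = droot \<mu> 0 p" for p
    using real_even[of p] by auto
  have C: "cnj (hop \<mu> 0) = hop \<mu> 0" by (simp add: hop_def)
  show "Re (sol1 \<mu> 0 x 0) = 0"
    unfolding sol1_def by (rule Re_fcoef_eq_0) (simp add: mode1_def even real C)
  define g where "g p = hop \<mu> 0 * of_real (sin p) / droot \<mu> 0 p" for p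
  have m: "mode2 \<mu> 0 0 = (\<lambda>p. 1 + g p)" by (simp add: mode2_def g_def fun_eq_iff)
  then have "g = (\<lambda>p. mode2 \<mu> 0 0 p - 1)" by simp
  then have g: "continuous_on {-pi..pi} g"
    by (auto intro!: continuous_intros continuous_on_modes' assms)
  have "sol2 \<mu> 0 x 0 = fcoef (\<lambda>_. 1) x + fcoef g x"
    unfolding sol2_def m by (intro fcoef_add continuous_intros g)
  moreover have "Re (fcoef g x) = 0"
    by (rule Re_fcoef_eq_0) (simp add: g_def even real C)
  ultimately show "Re (sol2 \<mu> 0 x 0) = (if x = 0 then 1 else 0)"
    by (simp add: fcoef_1)
qed

section \<open>Checker paths\<close>

text \<open>The end time is \<open>n + 1\<close> steps, so \<open>n = 0\<close> is the single path
  of one step, and \<open>n\<close> corresponds to \<bar>t\<bar> / \<epsilon> in the amplitude at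
  time \<bar>t\<bar> + \<epsilon>.\<close>

definition cpaths :: "real \<Rightarrow> nat \<Rightarrow> int \<Rightarrow> (real \<times> real) list set" where
  "cpaths \<epsilon> n x = {s. checker_path \<epsilon> s \<and> hd s = (0, 0) \<and>
     last s = (\<epsilon> * of_int x, \<epsilon> * of_nat (n + 1)) \<and> (\<epsilon>, \<epsilon>) \<in> set s}"

text \<open>The last step has direction \<open>d\<close>. It must be recorded because it decides
  whether the next step makes a turn.\<close>

definition dpaths :: "real \<Rightarrow> int \<Rightarrow> nat \<Rightarrow> int \<Rightarrow> (real \<times> real) list set" where
  "dpaths \<epsilon> d n x = cpaths \<epsilon> n x \<inter>
     range (\<lambda>r. r @ [(\<epsilon> * of_int (x - d), \<epsilon> * of_nat n), (\<epsilon> * of_int x, \<epsilon> * of_nat (n + 1))])"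

section \<open>Building checker paths point by point\<close>

lemma checker_path_singleton: "checker_path \<epsilon> [p] \<longleftrightarrow> p \<in> epsZ2 \<epsilon>"
  by (simp add: checker_path_def)

lemma checker_path_snoc:
  assumes "s \<noteq> []"
  shows "checker_path \<epsilon> (s @ [p]) \<longleftrightarrow> checker_path \<epsilon> s \<and> p \<in> epsZ2 \<epsilon> \<and>
    (fst p - fst (last s), snd p - snd (last s)) \<in> {(\<epsilon>, \<epsilon>), (-\<epsilon>, \<epsilon>)}"
proof -
  have "checker_path \<epsilon> s \<longleftrightarrow> s \<noteq> [] \<and> set s \<subseteq> epsZ2 \<epsilon> \<and>
     successively (\<lambda>p q. (fst q - fst p, snd q - snd p) \<in> {(\<epsilon>, \<epsilon>), (-\<epsilon>, \<epsilon>)}) s" for s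
    by (simp add: checker_path_def successively_conv_nth)
  then show ?thesis using assms by (auto simp: successively_append_iff)
qed

lemma snd_last_checker_path:
  assumes "checker_path \<epsilon> s" "hd s = (0, 0)"
  shows "snd (last s) = \<epsilon> * of_nat (length s - 1)"
  using assms
proof (induction s rule: rev_induct)
  case Nil
  then show ?case by (simp add: checker_path_def)
next
  case (snoc p s)
  show ?case
  proof (cases "s = []")
    case True
    then show ?thesis using snoc.prems by simp
  next
    case False
    then obtain k where "length s = Suc k" by (cases s) auto
    with False snoc show ?thesis by (auto simp: checker_path_snoc algebra_simps)
  qed
qed

lemma epsZ2_I: "(\<epsilon> * of_int a, \<epsilon> * of_nat b) \<in> epsZ2 \<epsilon>"
proof -
  have "(\<epsilon> * of_int a, \<epsilon> * of_nat b) = (\<epsilon> * of_int a, \<epsilon> * of_int (int b))" by simp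
  then show ?thesis unfolding epsZ2_def by blast
qed

lemma cpaths_0:
  assumes "\<epsilon> > 0"
  shows "cpaths \<epsilon> 0 x = (if x = 1 then {[(0, 0), (\<epsilon>, \<epsilon>)]} else {})"
proof -
  have Z: "(0, 0) \<in> epsZ2 \<epsilon>" "(\<epsilon>, \<epsilon>) \<in> epsZ2 \<epsilon>"
    using epsZ2_I[of \<epsilon> 0 0] epsZ2_I[of \<epsilon> 1 1] by simp_all
  have "x = 1 \<and> s = [(0, 0), (\<epsilon>, \<epsilon>)]" if "s \<in> cpaths \<epsilon> 0 x" for s
  proof -
    from that have s: "checker_path \<epsilon> s" "hd s = (0, 0)" "last s = (\<epsilon> * of_int x, \<epsilon>)" "(\<epsilon>, \<epsilon>) \<in> set s"
      by (auto simp: cpaths_def)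
    with snd_last_checker_path[of \<epsilon> s] assms have "length s = 2" by auto
    then obtain a b where "s = [a, b]" by (auto simp: length_Suc_conv numeral_2_eq_2)
    with s assms show ?thesis by auto
  qed
  moreover have "[(0, 0), (\<epsilon>, \<epsilon>)] \<in> cpaths \<epsilon> 0 1"
    using Z checker_path_snoc[of "[(0, 0)]" \<epsilon> "(\<epsilon>, \<epsilon>)"] by (simp add: cpaths_def checker_path_singleton)
  ultimately have "s \<in> cpaths \<epsilon> 0 x \<longleftrightarrow> x = 1 \<and> s = [(0, 0), (\<epsilon>, \<epsilon>)]" for s
    by blast
  then show ?thesis by (simp add: set_eq_iff)
qed

lemma cpaths_Suc_cases:
  assumes "\<epsilon> > 0" "s \<in> cpaths \<epsilon> (Suc n) x"
  obtains r d where "d = 1 \<or> d = -1" "r \<in> cpaths \<epsilon> n (x - d)"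
    "s = r @ [(\<epsilon> * of_int x, \<epsilon> * of_nat (n + 2))]"
proof -
  from assms have s: "checker_path \<epsilon> s" "hd s = (0, 0)"
      "last s = (\<epsilon> * of_int x, \<epsilon> * of_nat (n + 2))" "(\<epsilon>, \<epsilon>) \<in> set s"
    by (auto simp: cpaths_def)
  with snd_last_checker_path[of \<epsilon> s] assms have "real (length s - 1) = real (n + 2)" by simp
  then have "length s = Suc (Suc (Suc n))" by linarith
  then obtain r where r: "s = r @ [last s]" "r \<noteq> []"
    by (cases s rule: rev_cases) force+
  have "checker_path \<epsilon> (r @ [last s])" using r(1) s(1) by metis
  with checker_path_snoc[OF r(2)]
  have r': "checker_path \<epsilon> r" and
     "fst (last s) - fst (last r) = \<epsilon> \<or> fst (last s) - fst (last r) = - \<epsilon>" "snd (last s) - snd (last r) = \<epsilon>"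
    by auto
  then have "fst (last r) = \<epsilon> * of_int (x - 1) \<or> fst (last r) = \<epsilon> * of_int (x - (-1))"
    using s(3) by (auto simp: algebra_simps)
  then obtain d :: int where d: "d = 1 \<or> d = -1" "fst (last r) = \<epsilon> * of_int (x - d)"
    by blast
  have "snd (last r) = \<epsilon> * of_nat (n + 1)"
    using \<open>snd (last s) - snd (last r) = \<epsilon>\<close> s(3) by (simp add: algebra_simps)
  with d have "last r = (\<epsilon> * of_int (x - d), \<epsilon> * of_nat (n + 1))" by (simp add: prod_eq_iff)
  moreover have "hd r = (0, 0)" using r s(2) by (metis hd_append2)
  \<comment> \<open>The last point has time at least 2 \<epsilon>, so removing it does not remove
    the prescribed point.\<close>
  moreover have "(\<epsilon>, \<epsilon>) \<noteq> last s" using s(3) assms(1) by auto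
  then have "(\<epsilon>, \<epsilon>) \<in> set r" using s(4) r by (metis Un_iff empty_iff empty_set insert_iff list.set(2) set_append)
  ultimately have "r \<in> cpaths \<epsilon> n (x - d)" using r' by (simp add: cpaths_def)
  with that d(1) r(1) s(3) show thesis by metis
qed

lemma snoc_in_cpaths:
  assumes "d = 1 \<or> d = -1" "r \<in> cpaths \<epsilon> n (x - d)"
  shows "r @ [(\<epsilon> * of_int x, \<epsilon> * of_nat (n + 2))] \<in> cpaths \<epsilon> (Suc n) x"
proof -
  from assms(2) have r: "checker_path \<epsilon> r" "hd r = (0, 0)"
      "last r = (\<epsilon> * of_int (x - d), \<epsilon> * of_nat (n + 1))" "(\<epsilon>, \<epsilon>) \<in> set r"
    by (auto simp: cpaths_def)
  then have "r \<noteq> []" by auto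
  then show ?thesis
    using r assms(1) epsZ2_I[of \<epsilon> x "n + 2"]
    by (auto simp: cpaths_def checker_path_snoc algebra_simps)
qed

lemma cpaths_decomp:
  assumes "\<epsilon> > 0" "s \<in> cpaths \<epsilon> n x"
  shows "s \<in> dpaths \<epsilon> 1 n x \<or> s \<in> dpaths \<epsilon> (-1) n x"
proof (cases n)
  case 0
  with assms(2) have "x = 1" "s = [] @ [(\<epsilon> * of_int (x - 1), \<epsilon> * of_nat n), (\<epsilon> * of_int x, \<epsilon> * of_nat (n + 1))]"
    by (auto simp: cpaths_0[OF assms(1)] split: if_splits)
  with assms(2) show ?thesis unfolding dpaths_def by blast
next
  case (Suc k)
  from cpaths_Suc_cases[OF assms(1) assms(2)[unfolded Suc]] obtain r d
    where d: "d = 1 \<or> d = -1" and r: "r \<in> cpaths \<epsilon> k (x - d)" "s = r @ [(\<epsilon> * of_int x, \<epsilon> * of_nat (k + 2))]" .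
  from r(1) have "r \<noteq> []" "last r = (\<epsilon> * of_int (x - d), \<epsilon> * of_nat n)"
    by (auto simp: cpaths_def Suc checker_path_def)
  then have "r = butlast r @ [(\<epsilon> * of_int (x - d), \<epsilon> * of_nat n)]"
    by (metis append_butlast_last_id)
  then have "s = butlast r @ [(\<epsilon> * of_int (x - d), \<epsilon> * of_nat n), (\<epsilon> * of_int x, \<epsilon> * of_nat (n + 1))]"
    using r(2) by (metis Suc append.assoc append_Cons append_Nil Suc_eq_plus1 add_2_eq_Suc')
  with assms(2) have "s \<in> dpaths \<epsilon> d n x" unfolding dpaths_def by blast
  with d show ?thesis by auto
qed

lemma cpaths_eq_dpaths:
  assumes "\<epsilon> > 0"
  shows "cpaths \<epsilon> n x = dpaths \<epsilon> 1 n x \<union> dpaths \<epsilon> (-1) n x"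
    and "dpaths \<epsilon> 1 n x \<inter> dpaths \<epsilon> (-1) n x = {}"
proof -
  show "cpaths \<epsilon> n x = dpaths \<epsilon> 1 n x \<union> dpaths \<epsilon> (-1) n x"
    using cpaths_decomp[OF assms] unfolding dpaths_def by blast
  show "dpaths \<epsilon> 1 n x \<inter> dpaths \<epsilon> (-1) n x = {}"
    using assms unfolding dpaths_def by auto
qed

lemma dpaths_Suc:
  assumes "\<epsilon> > 0" "d = 1 \<or> d = -1"
  shows "dpaths \<epsilon> d (Suc n) x = (\<lambda>r. r @ [(\<epsilon> * of_int x, \<epsilon> * of_nat (n + 2))]) ` cpaths \<epsilon> n (x - d)" (is "?L = ?R")
proof
  show "?L \<subseteq> ?R"
  proof
    fix s assume "s \<in> ?L"
    then obtain q where s: "s \<in> cpaths \<epsilon> (Suc n) x"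
       and q: "s = q @ [(\<epsilon> * of_int (x - d), \<epsilon> * of_nat (n + 1)), (\<epsilon> * of_int x, \<epsilon> * of_nat (n + 2))]"
      by (auto simp: dpaths_def algebra_simps)
    from cpaths_Suc_cases[OF assms(1) s] obtain r d'
      where r: "r \<in> cpaths \<epsilon> n (x - d')" "s = r @ [(\<epsilon> * of_int x, \<epsilon> * of_nat (n + 2))]" .
    then have "r = q @ [(\<epsilon> * of_int (x - d), \<epsilon> * of_nat (n + 1))]" using q by simp
    moreover have "last r = (\<epsilon> * of_int (x - d'), \<epsilon> * of_nat (n + 1))" using r by (simp add: cpaths_def)
    ultimately have "d' = d" using assms(1) by simp
    with r show "s \<in> ?R" by simp
  qed
  show "?R \<subseteq> ?L"
  proof
    fix s assume "s \<in> ?R"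
    then obtain r where r: "r \<in> cpaths \<epsilon> n (x - d)" "s = r @ [(\<epsilon> * of_int x, \<epsilon> * of_nat (n + 2))]" by auto
    then have s: "s \<in> cpaths \<epsilon> (Suc n) x" using snoc_in_cpaths[OF assms(2)] by blast
    have "r \<noteq> []" "last r = (\<epsilon> * of_int (x - d), \<epsilon> * of_nat (Suc n))"
      using r(1) by (auto simp: cpaths_def checker_path_def)
    then have "r = butlast r @ [(\<epsilon> * of_int (x - d), \<epsilon> * of_nat (Suc n))]"
      by (metis append_butlast_last_id)
    then have "s = butlast r @ [(\<epsilon> * of_int (x - d), \<epsilon> * of_nat (Suc n)), (\<epsilon> * of_int x, \<epsilon> * of_nat (Suc n + 1))]"
      using r(2) by (metis append.assoc append_Cons append_Nil Suc_eq_plus1 add_2_eq_Suc')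
    with s show "s \<in> ?L" unfolding dpaths_def by blast
  qed
qed

lemma finite_cpaths:
  assumes "\<epsilon> > 0"
  shows "finite (cpaths \<epsilon> n x)"
proof (induction n arbitrary: x)
  case 0
  then show ?case by (simp add: cpaths_0[OF assms])
next
  case (Suc n)
  then show ?case by (simp add: cpaths_eq_dpaths(1)[OF assms, of "Suc n"] dpaths_Suc[OF assms])
qed

text \<open>Appending \<open>p\<close> makes \<open>b\<close> an interior point; all other interior
  points keep their neighbours. So at most the index of \<open>b\<close> is added to the set that is
  counted.\<close>

lemma turns_snoc:
  "turns (r @ [a, b, p]) = turns (r @ [a, b]) +
     (if (fst p - fst b) * (fst b - fst a) + (snd p - snd b) * (snd b - snd a) = 0 then 1 else 0)"
proof -
  define I where "I s = {i. 0 < i \<and> i + 1 < length s \<and>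
      (fst (s ! (i+1)) - fst (s ! i)) * (fst (s ! i) - fst (s ! (i-1))) +
      (snd (s ! (i+1)) - snd (s ! i)) * (snd (s ! i) - snd (s ! (i-1))) = (0::real)}" for s :: "(real \<times> real) list"
  define s where "s = r @ [a, b]"
  define k where "k = length r + 1"
  have len: "length s = k + 1" by (simp add: s_def k_def)
  have k: "k > 0" "(s @ [p]) ! k = b" "(s @ [p]) ! (k - 1) = a" "(s @ [p]) ! (k + 1) = p"
    by (simp_all add: s_def k_def nth_append)
  have fin: "finite (I s)" by (rule finite_subset[of _ "{..<length s}"]) (auto simp: I_def)
  have ni: "k \<notin> I s" by (simp add: I_def len)
  have iff: "i \<in> I (s @ [p]) \<longleftrightarrow> i \<in> I s" if "i \<noteq> k" for i
  proof (cases "i < k")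
    case True
    then have "(s @ [p]) ! (i+1) = s ! (i+1)" "(s @ [p]) ! i = s ! i" "(s @ [p]) ! (i-1) = s ! (i-1)"
      using len by (simp_all add: nth_append_left)
    then show ?thesis using True len by (simp add: I_def)
  qed (use that len in \<open>simp add: I_def\<close>)
  have "k \<in> I (s @ [p]) \<longleftrightarrow> (fst p - fst b) * (fst b - fst a) + (snd p - snd b) * (snd b - snd a) = 0"
    using k len by (simp add: I_def)
  then have "I (s @ [p]) = (if (fst p - fst b) * (fst b - fst a) + (snd p - snd b) * (snd b - snd a) = 0
     then insert k (I s) else I s)"
    using iff ni by (intro set_eqI) (metis insert_iff)
  then have "card (I (s @ [p])) = card (I s) + (if (fst p - fst b) * (fst b - fst a) + (snd p - snd b) * (snd b - snd a) = 0 then 1 else 0)"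
    using fin ni by simp
  then show ?thesis by (simp add: turns_def I_def s_def)
qed

text \<open>One more point lowers the exponent by 1/2, which gives the square root. The inner
  product of the last two steps is (d e + 1) \<epsilon>^2, so a turn is added exactly when the
  directions differ.\<close>

lemma path_amp_snoc:
  fixes m \<epsilon> :: real
  assumes "\<epsilon> > 0" "d = 1 \<or> d = -1" "e = 1 \<or> e = -1" "s \<in> dpaths \<epsilon> e n (x - d)"
  shows "path_amp m \<epsilon> (s @ [(\<epsilon> * of_int x, \<epsilon> * of_nat (n + 2))]) =
    of_real (1 / sqrt (1 + (m * \<epsilon>)\<^sup>2)) * (if e = d then 1 else - \<i> * of_real (m * \<epsilon>)) * path_amp m \<epsilon> s"
proof -
  obtain r where s: "s = r @ [(\<epsilon> * of_int (x - d - e), \<epsilon> * of_nat n), (\<epsilon> * of_int (x - d), \<epsilon> * of_nat (n + 1))]"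
    using assms(4) by (auto simp: dpaths_def)
  have "turns (s @ [(\<epsilon> * of_int x, \<epsilon> * of_nat (n + 2))]) = turns s + (if e = d then 0 else 1)"
    unfolding s using assms(1-3) by (auto simp: turns_snoc algebra_simps)
  moreover have "(1 + m\<^sup>2 * \<epsilon>\<^sup>2) powr (1 - real (Suc l) / 2) = 1 / sqrt (1 + (m * \<epsilon>)\<^sup>2) * (1 + m\<^sup>2 * \<epsilon>\<^sup>2) powr (1 - real l / 2)" for l
  proof -
    have pos: "1 + m\<^sup>2 * \<epsilon>\<^sup>2 > 0" by (simp add: add_pos_nonneg)
    have "1 - real (Suc l) / 2 = - (1 / 2) + (1 - real l / 2)" by (simp add: field_simps)
    then have "(1 + m\<^sup>2 * \<epsilon>\<^sup>2) powr (1 - real (Suc l) / 2)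
       = (1 + m\<^sup>2 * \<epsilon>\<^sup>2) powr (- (1 / 2)) * (1 + m\<^sup>2 * \<epsilon>\<^sup>2) powr (1 - real l / 2)"
      by (simp only: powr_add)
    also have "(1 + m\<^sup>2 * \<epsilon>\<^sup>2) powr (- (1 / 2)) = 1 / sqrt (1 + (m * \<epsilon>)\<^sup>2)"
      by (simp only: power_mult_distrib powr_minus_divide powr_half_sqrt[OF less_imp_le[OF pos]])
    finally show ?thesis .
  qed
  ultimately show ?thesis by (simp add: path_amp_def)
qed

section \<open>Amplitudes by last direction and the lattice Dirac equation\<close>

definition dir_amp :: "real \<Rightarrow> real \<Rightarrow> int \<Rightarrow> nat \<Rightarrow> int \<Rightarrow> complex" where
  "dir_amp m \<epsilon> d n x = (\<Sum>s\<in>dpaths \<epsilon> d n x. path_amp m \<epsilon> s)"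

lemma dir_amp_0:
  assumes "\<epsilon> > 0"
  shows "dir_amp m \<epsilon> 1 0 x = (if x = 1 then \<i> else 0)" "dir_amp m \<epsilon> (-1) 0 x = 0"
proof -
  have "dpaths \<epsilon> 1 0 x = (if x = 1 then {[(0, 0), (\<epsilon>, \<epsilon>)]} else {})" "dpaths \<epsilon> (-1) 0 x = {}"
    using assms by (auto simp: dpaths_def cpaths_0)
  moreover have "turns [(0, 0), (\<epsilon>, \<epsilon>)] = 0" by (auto simp: turns_def)
  then have "path_amp m \<epsilon> [(0, 0), (\<epsilon>, \<epsilon>)] = \<i>"
    using add_pos_nonneg[of 1 "m\<^sup>2 * \<epsilon>\<^sup>2"] by (simp add: path_amp_def)
  ultimately show "dir_amp m \<epsilon> 1 0 x = (if x = 1 then \<i> else 0)" "dir_amp m \<epsilon> (-1) 0 x = 0"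
    by (auto simp: dir_amp_def)
qed

lemma dir_amp_Suc:
  assumes "\<epsilon> > 0" "d = 1 \<or> d = -1"
  shows "dir_amp m \<epsilon> d (Suc n) x = of_real (1 / sqrt (1 + (m * \<epsilon>)\<^sup>2)) *
    (dir_amp m \<epsilon> d n (x - d) - \<i> * of_real (m * \<epsilon>) * dir_amp m \<epsilon> (- d) n (x - d))"
proof -
  define c where "c = complex_of_real (1 / sqrt (1 + (m * \<epsilon>)\<^sup>2))"
  define p where "p = (\<epsilon> * of_int x, \<epsilon> * of_nat (n + 2))"
  have amp: "path_amp m \<epsilon> (s @ [p]) = c * (if e = d then 1 else - \<i> * of_real (m * \<epsilon>)) * path_amp m \<epsilon> s"
    if "s \<in> dpaths \<epsilon> e n (x - d)" "e = 1 \<or> e = -1" for s e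
    unfolding c_def p_def by (rule path_amp_snoc[OF assms that(2,1)])
  have fin: "finite (dpaths \<epsilon> e n (x - d))" for e
    using finite_cpaths[OF assms(1)] by (simp add: dpaths_def)
  have un: "cpaths \<epsilon> n (x - d) = dpaths \<epsilon> d n (x - d) \<union> dpaths \<epsilon> (- d) n (x - d)"
    "dpaths \<epsilon> d n (x - d) \<inter> dpaths \<epsilon> (- d) n (x - d) = {}"
    using cpaths_eq_dpaths[OF assms(1), of n "x - d"] assms(2) by auto
  have "dir_amp m \<epsilon> d (Suc n) x = (\<Sum>s\<in>cpaths \<epsilon> n (x - d). path_amp m \<epsilon> (s @ [p]))"
    unfolding dir_amp_def dpaths_Suc[OF assms] p_def[symmetric]
    by (subst sum.reindex) (auto simp: inj_on_def)
  also have "\<dots> = (\<Sum>s\<in>dpaths \<epsilon> d n (x - d). path_amp m \<epsilon> (s @ [p]))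
      + (\<Sum>s\<in>dpaths \<epsilon> (- d) n (x - d). path_amp m \<epsilon> (s @ [p]))"
    unfolding un(1) by (rule sum.union_disjoint) (use fin un in auto)
  also have "(\<Sum>s\<in>dpaths \<epsilon> d n (x - d). path_amp m \<epsilon> (s @ [p])) = c * dir_amp m \<epsilon> d n (x - d)"
    unfolding dir_amp_def sum_distrib_left using assms(2) by (intro sum.cong refl) (simp add: amp)
  also have "(\<Sum>s\<in>dpaths \<epsilon> (- d) n (x - d). path_amp m \<epsilon> (s @ [p]))
      = c * (- \<i> * of_real (m * \<epsilon>)) * dir_amp m \<epsilon> (- d) n (x - d)"
    unfolding dir_amp_def sum_distrib_left
  proof (intro sum.cong refl)
    fix s assume "s \<in> dpaths \<epsilon> (- d) n (x - d)"
    from amp[OF this] assms(2)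
    show "path_amp m \<epsilon> (s @ [p]) = c * (- \<i> * of_real (m * \<epsilon>)) * path_amp m \<epsilon> s"
      by auto
  qed
  finally show ?thesis unfolding c_def by (simp add: algebra_simps)
qed

text \<open>The first step goes right with weight i and each turn contributes a factor -i m
  \<epsilon>, so an even number of turns (last step right) gives an imaginary value and an odd
  number (last step left) a real one. Hence the left part is \<open>a1\<close> and the right part is
  i times \<open>a2\<close>.\<close>

lemma dir_amp_Re_Im:
  assumes "\<epsilon> > 0"
  shows "Re (dir_amp m \<epsilon> 1 n x) = 0 \<and> Im (dir_amp m \<epsilon> (-1) n x) = 0"
proof (induction n arbitrary: x)
  case 0
  then show ?case by (simp add: dir_amp_0[OF assms])
next
  case (Suc n)
  have "dir_amp m \<epsilon> 1 (Suc n) x = of_real (1 / sqrt (1 + (m * \<epsilon>)\<^sup>2)) *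
      (dir_amp m \<epsilon> 1 n (x - 1) - \<i> * of_real (m * \<epsilon>) * dir_amp m \<epsilon> (-1) n (x - 1))"
    "dir_amp m \<epsilon> (-1) (Suc n) x = of_real (1 / sqrt (1 + (m * \<epsilon>)\<^sup>2)) *
      (dir_amp m \<epsilon> (-1) n (x + 1) - \<i> * of_real (m * \<epsilon>) * dir_amp m \<epsilon> 1 n (x + 1))"
    using dir_amp_Suc[OF assms, of 1] dir_amp_Suc[OF assms, of "-1"] by simp_all
  then show ?case using Suc.IH[of "x - 1"] Suc.IH[of "x + 1"] by simp
qed

lemma amp_eq_dir_amp:
  assumes "\<epsilon> > 0"
  shows "amp (\<epsilon> * of_int x) (\<epsilon> * of_nat (n + 1)) m \<epsilon> = dir_amp m \<epsilon> 1 n x + dir_amp m \<epsilon> (-1) n x"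
proof -
  have "amp (\<epsilon> * of_int x) (\<epsilon> * of_nat (n + 1)) m \<epsilon> = (\<Sum>s\<in>cpaths \<epsilon> n x. path_amp m \<epsilon> s)"
    by (simp only: amp_def cpaths_def)
  also have "\<dots> = dir_amp m \<epsilon> 1 n x + dir_amp m \<epsilon> (-1) n x"
    unfolding cpaths_eq_dpaths(1)[OF assms] dir_amp_def
    by (rule sum.union_disjoint)
      (use finite_cpaths[OF assms] cpaths_eq_dpaths(2)[OF assms] in \<open>auto simp: dpaths_def\<close>)
  finally show ?thesis .
qed

lemma a1_a2_0:
  assumes "\<epsilon> > 0"
  shows "a1 (\<epsilon> * of_int x) (\<epsilon> * of_nat (0 + 1)) m \<epsilon> = 0"
    and "a2 (\<epsilon> * of_int x) (\<epsilon> * of_nat (0 + 1)) m \<epsilon> = (if x = 1 then 1 else 0)"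
  unfolding a1_def a2_def amp_eq_dir_amp[OF assms] dir_amp_0[OF assms] by simp_all

lemma a1_a2_Suc:
  assumes "\<epsilon> > 0"
  shows "a1 (\<epsilon> * of_int x) (\<epsilon> * of_nat (Suc n + 1)) m \<epsilon> = 1 / sqrt (1 + (m * \<epsilon>)\<^sup>2) *
      (a1 (\<epsilon> * of_int (x + 1)) (\<epsilon> * of_nat (n + 1)) m \<epsilon> + m * \<epsilon> * a2 (\<epsilon> * of_int (x + 1)) (\<epsilon> * of_nat (n + 1)) m \<epsilon>)" (is ?A)
    and "a2 (\<epsilon> * of_int x) (\<epsilon> * of_nat (Suc n + 1)) m \<epsilon> = 1 / sqrt (1 + (m * \<epsilon>)\<^sup>2) *
      (a2 (\<epsilon> * of_int (x - 1)) (\<epsilon> * of_nat (n + 1)) m \<epsilon> - m * \<epsilon> * a1 (\<epsilon> * of_int (x - 1)) (\<epsilon> * of_nat (n + 1)) m \<epsilon>)" (is ?B)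
proof -
  note [simp] = dir_amp_Re_Im[OF assms, THEN conjunct1] dir_amp_Re_Im[OF assms, THEN conjunct2]
  have "dir_amp m \<epsilon> 1 (Suc n) x = of_real (1 / sqrt (1 + (m * \<epsilon>)\<^sup>2)) *
      (dir_amp m \<epsilon> 1 n (x - 1) - \<i> * of_real (m * \<epsilon>) * dir_amp m \<epsilon> (-1) n (x - 1))"
    "dir_amp m \<epsilon> (-1) (Suc n) x = of_real (1 / sqrt (1 + (m * \<epsilon>)\<^sup>2)) *
      (dir_amp m \<epsilon> (-1) n (x + 1) - \<i> * of_real (m * \<epsilon>) * dir_amp m \<epsilon> 1 n (x + 1))"
    using dir_amp_Suc[OF assms, of 1] dir_amp_Suc[OF assms, of "-1"] by simp_all
  then show ?A ?B
    unfolding a1_def a2_def amp_eq_dir_amp[OF assms] by simp_all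
qed

section \<open>Lattice points and the limit\<close>

text \<open>Integrality of (x + t) / \<epsilon> forces 2x / \<epsilon> and 2t / \<epsilon> to have
  equal parity. An odd point is labelled by the integer point \<open>(i, j)\<close> whose
  \<open>A1\<close> equation in axiom 1 reads it, hence the opposite signs of the half
  steps.\<close>

lemma Leps_cases:
  assumes "\<epsilon> > 0" "(x, t) \<in> Leps \<epsilon>"
  obtains i j :: int where "x = \<epsilon> * of_int i" "t = \<epsilon> * of_int j"
    | i j :: int where "x = \<epsilon> * of_int i + \<epsilon> / 2" "t = \<epsilon> * of_int j - \<epsilon> / 2"
proof -
  from assms(2) obtain k l n :: int where k: "2 * x / \<epsilon> = of_int k" "2 * t / \<epsilon> = of_int l" "(x + t) / \<epsilon> = of_int n"
    by (auto simp: Leps_def elim!: Ints_cases)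
  then have x: "x = \<epsilon> * of_int k / 2" "t = \<epsilon> * of_int l / 2"
    using assms(1) by (simp_all add: field_simps)
  have "2 * x / \<epsilon> + 2 * t / \<epsilon> = 2 * ((x + t) / \<epsilon>)"
    by (simp add: add_divide_distrib)
  then have "of_int (k + l) = (of_int (2 * n) :: real)"
    unfolding k by simp
  then have kl: "k + l = 2 * n" by (simp only: of_int_eq_iff)
  show thesis
  proof (cases "even k")
    case True
    moreover from this kl have "even l" by presburger
    ultimately obtain i j where "k = 2 * i" "l = 2 * j" by (auto elim!: evenE)
    then show thesis using x by (intro that(1)[of i j]) auto
  next
    case False
    moreover from this kl have "odd l" by presburger
    ultimately obtain i j where "k = 2 * i + 1" "l = 2 * j + 1" by (auto elim!: oddE)
    then show thesis using x by (intro that(2)[of i "j + 1"]) (auto simp: field_simps)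
  qed
qed

lemma even_point_Leps:
  assumes "\<epsilon> > 0"
  shows "(\<epsilon> * of_int i, \<epsilon> * of_int j) \<in> Leps \<epsilon>"
    "even_real (2 * (\<epsilon> * of_int i) / \<epsilon>)" "\<not> odd_real (2 * (\<epsilon> * of_int i) / \<epsilon>)"
proof -
  have e: "2 * (\<epsilon> * of_int k) / \<epsilon> = of_int (2 * k)" for k using assms by simp
  have "(\<epsilon> * of_int i + \<epsilon> * of_int j) / \<epsilon> = of_int (i + j)" using assms by (simp add: field_simps)
  then show "(\<epsilon> * of_int i, \<epsilon> * of_int j) \<in> Leps \<epsilon>" unfolding Leps_def e by (simp only: mem_Collect_eq case_prod_conv e Ints_of_int)
  show "even_real (2 * (\<epsilon> * of_int i) / \<epsilon>)" "\<not> odd_real (2 * (\<epsilon> * of_int i) / \<epsilon>)"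
    unfolding e even_real_def odd_real_def of_int_eq_iff by auto
qed

lemma odd_point_Leps:
  assumes "\<epsilon> > 0"
  shows "(\<epsilon> * of_int i + \<epsilon> / 2, \<epsilon> * of_int j - \<epsilon> / 2) \<in> Leps \<epsilon>"
    "odd_real (2 * (\<epsilon> * of_int i + \<epsilon> / 2) / \<epsilon>)" "odd_real (2 * (\<epsilon> * of_int j - \<epsilon> / 2) / \<epsilon>)"
    "\<not> even_real (2 * (\<epsilon> * of_int i + \<epsilon> / 2) / \<epsilon>)"
proof -
  have e: "2 * (\<epsilon> * of_int i + \<epsilon> / 2) / \<epsilon> = of_int (2 * i + 1)" "2 * (\<epsilon> * of_int j - \<epsilon> / 2) / \<epsilon> = of_int (2 * j - 1)"
    "(\<epsilon> * of_int i + \<epsilon> / 2 + (\<epsilon> * of_int j - \<epsilon> / 2)) / \<epsilon> = of_int (i + j)"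
    using assms by (simp_all add: field_simps)
  show "(\<epsilon> * of_int i + \<epsilon> / 2, \<epsilon> * of_int j - \<epsilon> / 2) \<in> Leps \<epsilon>"
    unfolding Leps_def by (simp only: mem_Collect_eq case_prod_conv e Ints_of_int)
  have o: "odd (2 * i + 1)" "odd (2 * j - 1)" by simp_all
  show "odd_real (2 * (\<epsilon> * of_int i + \<epsilon> / 2) / \<epsilon>)" "odd_real (2 * (\<epsilon> * of_int j - \<epsilon> / 2) / \<epsilon>)"
    "\<not> even_real (2 * (\<epsilon> * of_int i + \<epsilon> / 2) / \<epsilon>)"
    unfolding e even_real_def odd_real_def of_int_eq_iff using o by blast+
qed

lemma axiom1_iff:
  assumes "\<epsilon> > 0"
  shows "axiom1 m \<epsilon> A1 A2 \<longleftrightarrow> (\<forall>i j :: int.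
     A1 (\<epsilon> * of_int i, \<epsilon> * of_int j) = of_real (1 / sqrt (1 + (m * \<epsilon>)\<^sup>2)) *
        (A1 (\<epsilon> * of_int i + \<epsilon> / 2, \<epsilon> * of_int j - \<epsilon> / 2)
          + of_real (m * \<epsilon>) * A2 (\<epsilon> * of_int i + \<epsilon> / 2, \<epsilon> * of_int j - \<epsilon> / 2)) \<and>
     A2 (\<epsilon> * of_int i, \<epsilon> * of_int j) = of_real (1 / sqrt (1 + (m * \<epsilon>)\<^sup>2)) *
        (A2 (\<epsilon> * of_int (i - 1) + \<epsilon> / 2, \<epsilon> * of_int j - \<epsilon> / 2)
          - of_real (m * \<epsilon>) * A1 (\<epsilon> * of_int (i - 1) + \<epsilon> / 2, \<epsilon> * of_int j - \<epsilon> / 2))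
        + (if i = 0 \<and> j = 0 then 2 else 0))" (is "_ \<longleftrightarrow> (\<forall>i j. ?E i j)")
proof -
  define P where "P x t \<longleftrightarrow> A1 (x,t) = complex_of_real (1 / sqrt (1 + m\<^sup>2 * \<epsilon>\<^sup>2)) *
        (A1 (x + \<epsilon>/2, t - \<epsilon>/2) + complex_of_real (m * \<epsilon>) * A2 (x + \<epsilon>/2, t - \<epsilon>/2)) \<and>
     A2 (x,t) = complex_of_real (1 / sqrt (1 + m\<^sup>2 * \<epsilon>\<^sup>2)) *
        (A2 (x - \<epsilon>/2, t - \<epsilon>/2) - complex_of_real (m * \<epsilon>) * A1 (x - \<epsilon>/2, t - \<epsilon>/2))
        + 2 * (if x = 0 then 1 else 0) * (if t = 0 then 1 else 0)" for x t
  \<comment> \<open>The \<open>A2\<close> equation at \<open>(i, j)\<close> reads the odd point half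
    a step to the left, which carries the label \<open>i - 1\<close>.\<close>
  have shift: "\<epsilon> * of_int i - \<epsilon> / 2 = \<epsilon> * of_int (i - 1) + \<epsilon> / 2" for i
    by (simp add: algebra_simps)
  have src: "2 * (if \<epsilon> * of_int i = 0 then 1 else 0) * (if \<epsilon> * of_int j = 0 then 1 else 0)
      = (if i = 0 \<and> j = 0 then 2 else (0::complex))" for i j
    using assms by simp
  have E: "?E i j \<longleftrightarrow> P (\<epsilon> * of_int i) (\<epsilon> * of_int j)" for i j
    unfolding P_def src shift[of i] power_mult_distrib ..
  have "axiom1 m \<epsilon> A1 A2 \<longleftrightarrow> (\<forall>x t. (x,t) \<in> Leps \<epsilon> \<and> even_real (2*x/\<epsilon>) \<and> even_real (2*t/\<epsilon>) \<longrightarrow> P x t)"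
    unfolding axiom1_def P_def ..
  also have "\<dots> \<longleftrightarrow> (\<forall>i j :: int. P (\<epsilon> * of_int i) (\<epsilon> * of_int j))"
    using even_point_Leps[OF assms] odd_point_Leps(4)[OF assms] Leps_cases[OF assms] by metis
  finally show ?thesis by (simp only: E)
qed

lemma axiom2_iff:
  assumes "\<epsilon> > 0"
  shows "axiom2 \<epsilon> \<delta> A1 A2 \<longleftrightarrow> (\<forall>i j :: int.
     A1 (\<epsilon> * of_int i + \<epsilon> / 2, \<epsilon> * of_int j - \<epsilon> / 2) = of_real (1 / sqrt (1 - \<delta>\<^sup>2)) *
        (A1 (\<epsilon> * of_int (i + 1), \<epsilon> * of_int (j - 1)) - \<i> * of_real \<delta> * A2 (\<epsilon> * of_int (i + 1), \<epsilon> * of_int (j - 1))) \<and>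
     A2 (\<epsilon> * of_int i + \<epsilon> / 2, \<epsilon> * of_int j - \<epsilon> / 2) = of_real (1 / sqrt (1 - \<delta>\<^sup>2)) *
        (A2 (\<epsilon> * of_int i, \<epsilon> * of_int (j - 1)) + \<i> * of_real \<delta> * A1 (\<epsilon> * of_int i, \<epsilon> * of_int (j - 1))))"
    (is "_ \<longleftrightarrow> (\<forall>i j. ?E i j)")
proof -
  define P where "P x t \<longleftrightarrow> A1 (x,t) = complex_of_real (1 / sqrt (1 - \<delta>\<^sup>2)) *
        (A1 (x + \<epsilon>/2, t - \<epsilon>/2) - \<i> * complex_of_real \<delta> * A2 (x + \<epsilon>/2, t - \<epsilon>/2)) \<and>
     A2 (x,t) = complex_of_real (1 / sqrt (1 - \<delta>\<^sup>2)) *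
        (A2 (x - \<epsilon>/2, t - \<epsilon>/2) + \<i> * complex_of_real \<delta> * A1 (x - \<epsilon>/2, t - \<epsilon>/2))" for x t
  have shift: "\<epsilon> * of_int i + \<epsilon> / 2 + \<epsilon> / 2 = \<epsilon> * of_int (i + 1)"
    "\<epsilon> * of_int i + \<epsilon> / 2 - \<epsilon> / 2 = \<epsilon> * of_int i"
    "\<epsilon> * of_int i - \<epsilon> / 2 - \<epsilon> / 2 = \<epsilon> * of_int (i - 1)" for i
    by (simp_all add: algebra_simps)
  have E: "?E i j \<longleftrightarrow> P (\<epsilon> * of_int i + \<epsilon> / 2) (\<epsilon> * of_int j - \<epsilon> / 2)" for i j
    unfolding P_def shift ..
  have "axiom2 \<epsilon> \<delta> A1 A2 \<longleftrightarrow> (\<forall>x t. (x,t) \<in> Leps \<epsilon> \<and> odd_real (2*x/\<epsilon>) \<and> odd_real (2*t/\<epsilon>) \<longrightarrow> P x t)"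
    unfolding axiom2_def P_def ..
  also have "\<dots> \<longleftrightarrow> (\<forall>i j :: int. P (\<epsilon> * of_int i + \<epsilon> / 2) (\<epsilon> * of_int j - \<epsilon> / 2))"
    using odd_point_Leps[OF assms] even_point_Leps(3)[OF assms] Leps_cases[OF assms] by metis
  finally show ?thesis by (simp only: E)
qed

lemma axiom3_iff:
  assumes "\<epsilon> > 0"
  shows "axiom3 \<epsilon> A1 A2 \<longleftrightarrow> (\<lambda>(i, j). (cmod (A1 (\<epsilon> * of_int i, \<epsilon> * of_int j)))\<^sup>2
      + (cmod (A2 (\<epsilon> * of_int i, \<epsilon> * of_int j)))\<^sup>2) summable_on (UNIV :: (int \<times> int) set)"
proof -
  define h :: "int \<times> int \<Rightarrow> real \<times> real" where "h = (\<lambda>(i, j). (\<epsilon> * of_int i, \<epsilon> * of_int j))"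
  have "epsZ2 \<epsilon> = range h" by (auto simp: epsZ2_def h_def)
  moreover have "inj h" using assms by (auto simp: inj_on_def h_def)
  ultimately show ?thesis
    unfolding axiom3_def by (simp add: summable_on_reindex o_def h_def case_prod_unfold)
qed

section \<open>Equivalence of the axioms with the evolution on integer points\<close>

lemma evol_if_dirac_axioms:
  assumes "\<epsilon> > 0" "dirac_axioms m \<epsilon> \<delta> A1 A2"
  defines "f1 \<equiv> \<lambda>i j :: int. A1 (\<epsilon> * of_int i, \<epsilon> * of_int j)"
    and "f2 \<equiv> \<lambda>i j :: int. A2 (\<epsilon> * of_int i, \<epsilon> * of_int j)"
  shows "evol (m * \<epsilon>) \<delta> 2 f1 f2" "(\<lambda>(i, j). (cmod (f1 i j))\<^sup>2 + (cmod (f2 i j))\<^sup>2) summable_on UNIV"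
proof -
  from assms(2) have ax: "axiom1 m \<epsilon> A1 A2" "axiom2 \<epsilon> \<delta> A1 A2" "axiom3 \<epsilon> A1 A2"
    by (simp_all add: dirac_axioms_def)
  show "(\<lambda>(i, j). (cmod (f1 i j))\<^sup>2 + (cmod (f2 i j))\<^sup>2) summable_on UNIV"
    using ax(3) unfolding axiom3_iff[OF assms(1)] f1_def f2_def .
  have f: "A1 (\<epsilon> * of_int i, \<epsilon> * of_int j) = f1 i j" "A2 (\<epsilon> * of_int i, \<epsilon> * of_int j) = f2 i j" for i j
    by (simp_all add: f1_def f2_def)
  note 1 = ax(1)[unfolded axiom1_iff[OF assms(1)], rule_format, unfolded f]
  note 2 = ax(2)[unfolded axiom2_iff[OF assms(1)], rule_format, unfolded f]
  have "f1 x t = hop (m * \<epsilon>) \<delta> * (f1 (x+1) (t-1) - \<i> * of_real \<delta> * f2 (x+1) (t-1)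
        + of_real (m * \<epsilon>) * (f2 x (t-1) + \<i> * of_real \<delta> * f1 x (t-1)))" for x t
    unfolding 1[of x t, THEN conjunct1] 2[of x t, THEN conjunct1] 2[of x t, THEN conjunct2]
    by (simp add: hop_def algebra_simps)
  moreover have "f2 x t = hop (m * \<epsilon>) \<delta> * (f2 (x-1) (t-1) + \<i> * of_real \<delta> * f1 (x-1) (t-1)
        - of_real (m * \<epsilon>) * (f1 x (t-1) - \<i> * of_real \<delta> * f2 x (t-1)))
        + (if x = 0 \<and> t = 0 then 2 else 0)" for x t
    unfolding 1[of x t, THEN conjunct2] 2[of "x-1" t, THEN conjunct1] 2[of "x-1" t, THEN conjunct2]
    by (simp add: hop_def algebra_simps)
  ultimately show "evol (m * \<epsilon>) \<delta> 2 f1 f2"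
    unfolding evol_def by blast
qed

lemma dirac_axioms_if_evol:
  assumes "\<epsilon> > 0" "evol (m * \<epsilon>) \<delta> 2 f1 f2"
    and "(\<lambda>(i, j). (cmod (f1 i j))\<^sup>2 + (cmod (f2 i j))\<^sup>2) summable_on UNIV"
  shows "\<exists>A1 A2. dirac_axioms m \<epsilon> \<delta> A1 A2"
proof -
  define s where "s = complex_of_real (1 / sqrt (1 - \<delta>\<^sup>2))"
  \<comment> \<open>Values at odd points are forced by axiom 2. The floors only recover integer
    labels from real coordinates; outside \<open>Leps\<close> the resulting values are
    arbitrary.\<close>
  define A1 where "A1 p = (if p \<in> epsZ2 \<epsilon> then f1 \<lfloor>fst p / \<epsilon>\<rfloor> \<lfloor>snd p / \<epsilon>\<rfloor>
    else s * (f1 \<lfloor>fst p / \<epsilon> + 1/2\<rfloor> \<lfloor>snd p / \<epsilon> - 1/2\<rfloor> - \<i> * of_real \<delta> * f2 \<lfloor>fst p / \<epsilon> + 1/2\<rfloor> \<lfloor>snd p / \<epsilon> - 1/2\<rfloor>))" for p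
  define A2 where "A2 p = (if p \<in> epsZ2 \<epsilon> then f2 \<lfloor>fst p / \<epsilon>\<rfloor> \<lfloor>snd p / \<epsilon>\<rfloor>
    else s * (f2 \<lfloor>fst p / \<epsilon> - 1/2\<rfloor> \<lfloor>snd p / \<epsilon> - 1/2\<rfloor> + \<i> * of_real \<delta> * f1 \<lfloor>fst p / \<epsilon> - 1/2\<rfloor> \<lfloor>snd p / \<epsilon> - 1/2\<rfloor>))" for p
  have even: "A1 (\<epsilon> * of_int i, \<epsilon> * of_int j) = f1 i j" "A2 (\<epsilon> * of_int i, \<epsilon> * of_int j) = f2 i j" for i j
  proof -
    have "(\<epsilon> * of_int i, \<epsilon> * of_int j) \<in> epsZ2 \<epsilon>" unfolding epsZ2_def by blast
    then show "A1 (\<epsilon> * of_int i, \<epsilon> * of_int j) = f1 i j" "A2 (\<epsilon> * of_int i, \<epsilon> * of_int j) = f2 i j"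
      using assms(1) by (simp_all add: A1_def A2_def)
  qed
  have odd: "A1 (\<epsilon> * of_int i + \<epsilon> / 2, \<epsilon> * of_int j - \<epsilon> / 2) = s * (f1 (i+1) (j-1) - \<i> * of_real \<delta> * f2 (i+1) (j-1))"
    "A2 (\<epsilon> * of_int i + \<epsilon> / 2, \<epsilon> * of_int j - \<epsilon> / 2) = s * (f2 i (j-1) + \<i> * of_real \<delta> * f1 i (j-1))" for i j
  proof -
    have "(\<epsilon> * of_int i + \<epsilon> / 2, \<epsilon> * of_int j - \<epsilon> / 2) \<notin> epsZ2 \<epsilon>"
    proof
      assume "(\<epsilon> * of_int i + \<epsilon> / 2, \<epsilon> * of_int j - \<epsilon> / 2) \<in> epsZ2 \<epsilon>"
      then obtain a :: int where "\<epsilon> * of_int i + \<epsilon> / 2 = \<epsilon> * of_int a" by (auto simp: epsZ2_def)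
      then show False
        using odd_point_Leps(4)[OF assms(1), of i] even_point_Leps(2)[OF assms(1), of a] by simp
    qed
    moreover have "\<lfloor>(\<epsilon> * of_int i + \<epsilon> / 2) / \<epsilon> + 1/2\<rfloor> = i + 1" "\<lfloor>(\<epsilon> * of_int i + \<epsilon> / 2) / \<epsilon> - 1/2\<rfloor> = i"
      "\<lfloor>(\<epsilon> * of_int j - \<epsilon> / 2) / \<epsilon> - 1/2\<rfloor> = j - 1"
      using assms(1) by (simp_all add: add_divide_distrib diff_divide_distrib)
    ultimately show "A1 (\<epsilon> * of_int i + \<epsilon> / 2, \<epsilon> * of_int j - \<epsilon> / 2) = s * (f1 (i+1) (j-1) - \<i> * of_real \<delta> * f2 (i+1) (j-1))"
       "A2 (\<epsilon> * of_int i + \<epsilon> / 2, \<epsilon> * of_int j - \<epsilon> / 2) = s * (f2 i (j-1) + \<i> * of_real \<delta> * f1 i (j-1))"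
      by (simp_all only: A1_def A2_def fst_conv snd_conv if_False)
  qed
  have "axiom1 m \<epsilon> A1 A2"
    unfolding axiom1_iff[OF assms(1)] even odd
  proof (intro allI)
    fix i j
    note e = assms(2)[unfolded evol_def, rule_format, of i j]
    show "f1 i j = of_real (1 / sqrt (1 + (m * \<epsilon>)\<^sup>2)) *
        (s * (f1 (i+1) (j-1) - \<i> * of_real \<delta> * f2 (i+1) (j-1))
         + of_real (m * \<epsilon>) * (s * (f2 i (j-1) + \<i> * of_real \<delta> * f1 i (j-1)))) \<and>
      f2 i j = of_real (1 / sqrt (1 + (m * \<epsilon>)\<^sup>2)) *
        (s * (f2 (i-1) (j-1) + \<i> * of_real \<delta> * f1 (i-1) (j-1))
         - of_real (m * \<epsilon>) * (s * (f1 (i-1+1) (j-1) - \<i> * of_real \<delta> * f2 (i-1+1) (j-1))))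
        + (if i = 0 \<and> j = 0 then 2 else 0)"
      unfolding e[THEN conjunct1] e[THEN conjunct2]
      by (simp add: hop_def s_def algebra_simps)
  qed
  moreover have "axiom2 \<epsilon> \<delta> A1 A2"
    unfolding axiom2_iff[OF assms(1)] even odd by (simp add: s_def)
  moreover have "axiom3 \<epsilon> A1 A2"
    unfolding axiom3_iff[OF assms(1)] even by (rule assms(3))
  ultimately show ?thesis unfolding dirac_axioms_def by blast
qed

lemma dirac_axioms_eq_sol:
  assumes "\<epsilon> > 0" "m > 0" "0 < \<delta>" "\<delta> < 1" "dirac_axioms m \<epsilon> \<delta> A1 A2"
  shows "A1 (\<epsilon> * of_int i, \<epsilon> * of_int j) = sol1 (m * \<epsilon>) \<delta> i j"
    and "A2 (\<epsilon> * of_int i, \<epsilon> * of_int j) = sol2 (m * \<epsilon>) \<delta> i j"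
proof -
  have \<mu>: "m * \<epsilon> > 0" "m * \<epsilon> \<noteq> 0" "0 \<le> \<delta>" using assms by simp_all
  note u = evol_unique[OF \<mu>(2) assms(3,4) evol_if_dirac_axioms[OF assms(1,5)]
      evol_sol[OF \<mu>(1,3) assms(4)] sol_square_summable[OF \<mu>(1) assms(3,4)]]
  show "A1 (\<epsilon> * of_int i, \<epsilon> * of_int j) = sol1 (m * \<epsilon>) \<delta> i j"
    "A2 (\<epsilon> * of_int i, \<epsilon> * of_int j) = sol2 (m * \<epsilon>) \<delta> i j"
    using u[THEN fun_cong, THEN fun_cong] by simp_all
qed

text \<open>At integer points both pairs equal the Fourier solution, and axiom 2 determines the odd
  points from these.\<close>

lemma dirac_axioms_unique:
  assumes "\<epsilon> > 0" "m > 0" "0 < \<delta>" "\<delta> < 1"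
    and A: "dirac_axioms m \<epsilon> \<delta> A1 A2" and B: "dirac_axioms m \<epsilon> \<delta> B1 B2" and "p \<in> Leps \<epsilon>"
  shows "B1 p = A1 p" "B2 p = A2 p"
proof -
  have even: "B1 (\<epsilon> * of_int i, \<epsilon> * of_int j) = A1 (\<epsilon> * of_int i, \<epsilon> * of_int j)"
    "B2 (\<epsilon> * of_int i, \<epsilon> * of_int j) = A2 (\<epsilon> * of_int i, \<epsilon> * of_int j)" for i j
    using dirac_axioms_eq_sol[OF assms(1-4) A] dirac_axioms_eq_sol[OF assms(1-4) B] by simp_all
  have ax: "axiom2 \<epsilon> \<delta> A1 A2" "axiom2 \<epsilon> \<delta> B1 B2"
    using A B by (simp_all add: dirac_axioms_def)
  note ax' = ax(1)[unfolded axiom2_iff[OF assms(1)], rule_format]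
    ax(2)[unfolded axiom2_iff[OF assms(1)], rule_format]
  obtain x t where p: "p = (x, t)" by (cases p)
  from Leps_cases[OF assms(1) assms(7)[unfolded p]]
  have "B1 p = A1 p \<and> B2 p = A2 p"
  proof cases
    case (1 i j)
    then show ?thesis unfolding p by (simp add: even)
  next
    case (2 i j)
    show ?thesis unfolding p 2 ax'(1)[THEN conjunct1] ax'(1)[THEN conjunct2]
      ax'(2)[THEN conjunct1] ax'(2)[THEN conjunct2] even by simp
  qed
  then show "B1 p = A1 p" "B2 p = A2 p" by simp_all
qed

section \<open>The limit field and the checker amplitudes\<close>

lemma Re_evol:
  assumes "evol \<mu> 0 2 f1 f2"
  shows "Re (f1 x (t+1)) = 1 / sqrt (1 + \<mu>\<^sup>2) * (Re (f1 (x+1) t) + \<mu> * Re (f2 x t))"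
    and "t + 1 \<noteq> 0 \<Longrightarrow> Re (f2 x (t+1)) = 1 / sqrt (1 + \<mu>\<^sup>2) * (Re (f2 (x-1) t) - \<mu> * Re (f1 x t))"
    and "Re (f1 x (t-1)) = 1 / sqrt (1 + \<mu>\<^sup>2) *
        (Re (f1 (x-1) t) - \<mu> * (Re (f2 x t) - (if x = 0 \<and> t = 0 then 2 else 0)))"
    and "Re (f2 x (t-1)) = 1 / sqrt (1 + \<mu>\<^sup>2) *
        (Re (f2 (x+1) t) - (if x + 1 = 0 \<and> t = 0 then 2 else 0) + \<mu> * Re (f1 x t))"
proof -
  \<comment> \<open>At \<delta> = 0 every coefficient of the evolution and of its inverse is real,
    so the real parts obey the recursions on their own.\<close>
  have d: "hop \<mu> 0 = of_real (1 / sqrt (1 + \<mu>\<^sup>2))" by (simp add: hop_def)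
  note f = assms[unfolded evol_def d, rule_format, of x "t + 1"]
  show "Re (f1 x (t+1)) = 1 / sqrt (1 + \<mu>\<^sup>2) * (Re (f1 (x+1) t) + \<mu> * Re (f2 x t))"
    unfolding f[THEN conjunct1] by simp
  show "Re (f2 x (t+1)) = 1 / sqrt (1 + \<mu>\<^sup>2) * (Re (f2 (x-1) t) - \<mu> * Re (f1 x t))" if "t + 1 \<noteq> 0"
    unfolding f[THEN conjunct2] using that by simp
  have "\<bar>0 :: real\<bar> < 1" by simp
  note b = evol_backward[OF assms this refl, where x = x and t = t, unfolded d]
  show "Re (f1 x (t-1)) = 1 / sqrt (1 + \<mu>\<^sup>2) *
        (Re (f1 (x-1) t) - \<mu> * (Re (f2 x t) - (if x = 0 \<and> t = 0 then 2 else 0)))"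
    unfolding b(1) by simp
  show "Re (f2 x (t-1)) = 1 / sqrt (1 + \<mu>\<^sup>2) *
        (Re (f2 (x+1) t) - (if x + 1 = 0 \<and> t = 0 then 2 else 0) + \<mu> * Re (f1 x t))"
    unfolding b(2) by simp
qed

text \<open>Forward in time the real parts and the amplitudes share a recursion and the data at t =
  0. Backward in time the recursion is the mirror image, so the comparison also needs the symmetry
  of \<open>a1\<close> in \<open>x\<close>.\<close>

lemma Re_sol:
  assumes "\<epsilon> > 0" "m > 0"
  shows "Re (sol1 (m * \<epsilon>) 0 x t) = a1 (\<epsilon> * of_int x) (\<epsilon> * of_nat (nat \<bar>t\<bar> + 1)) m \<epsilon>"
    and "Re (sol2 (m * \<epsilon>) 0 x t) = (if t < 0 then - a2 (\<epsilon> * of_int (- x + 1)) (\<epsilon> * of_nat (nat \<bar>t\<bar> + 1)) m \<epsilon>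
        else a2 (\<epsilon> * of_int (x + 1)) (\<epsilon> * of_nat (nat \<bar>t\<bar> + 1)) m \<epsilon>)"
proof -
  define \<mu> where "\<mu> = m * \<epsilon>"
  define c where "c = 1 / sqrt (1 + \<mu>\<^sup>2)"
  define r1 where "r1 x t = Re (sol1 \<mu> 0 x t)" for x t
  define r2 where "r2 x t = Re (sol2 \<mu> 0 x t)" for x t
  define b1 where "b1 n x = a1 (\<epsilon> * of_int x) (\<epsilon> * of_nat (n + 1)) m \<epsilon>" for n x
  define b2 where "b2 n x = a2 (\<epsilon> * of_int x) (\<epsilon> * of_nat (n + 1)) m \<epsilon>" for n x
  have "\<mu> > 0" using assms by (simp add: \<mu>_def)
  then have "evol \<mu> 0 2 (sol1 \<mu> 0) (sol2 \<mu> 0)" by (intro evol_sol) simp_all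
  note r = Re_evol[OF this, folded c_def r1_def r2_def]
  have r0: "r1 x 0 = 0" "r2 x 0 = (if x = 0 then 1 else 0)" for x
    unfolding r1_def r2_def by (rule Re_sol_initial[OF \<open>\<mu> > 0\<close>])+
  have b0: "b1 0 x = 0" "b2 0 x = (if x = 1 then 1 else 0)" for x
    unfolding b1_def b2_def by (rule a1_a2_0[OF assms(1)])+
  have bS: "b1 (Suc n) x = c * (b1 n (x + 1) + \<mu> * b2 n (x + 1))"
    "b2 (Suc n) x = c * (b2 n (x - 1) - \<mu> * b1 n (x - 1))" for n x
    unfolding b1_def b2_def c_def \<mu>_def by (rule a1_a2_Suc[OF assms(1)])+
  have forward: "(\<forall>x. r1 x (int n) = b1 n x) \<and> (\<forall>x. r2 x (int n) = b2 n (x + 1))" for n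
  proof (induction n)
    case 0
    then show ?case by (simp add: r0 b0)
  next
    case (Suc n)
    have "r1 x (int n + 1) = b1 (Suc n) x" "r2 x (int n + 1) = b2 (Suc n) (x + 1)" for x
      using Suc r(2)[of "int n" x] by (simp_all add: r(1) bS)
    then show ?case by (simp add: add.commute)
  qed
  \<comment> \<open>This second-order equation involves \<open>b1\<close> only and is invariant
    under reflection of \<open>x\<close>, so evenness follows by induction from \<open>n = 0\<close>
    and \<open>n = 1\<close>.\<close>
  have wave: "b1 (Suc (Suc n)) x = c * (b1 (Suc n) (x + 1) + b1 (Suc n) (x - 1)) - b1 n x" for n x
  proof -
    have "r1 x (int (Suc n) + 1) + r1 x (int (Suc n) - 1)
        = c * (r1 (x + 1) (int (Suc n)) + r1 (x - 1) (int (Suc n)))"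
      unfolding r(1) r(3) by (simp add: algebra_simps)
    moreover have "int (Suc n) + 1 = int (Suc (Suc n))" "int (Suc n) - 1 = int n" by simp_all
    ultimately have "b1 (Suc (Suc n)) x + b1 n x = c * (b1 (Suc n) (x + 1) + b1 (Suc n) (x - 1))"
      by (simp only: forward[THEN conjunct1, rule_format])
    then show ?thesis by simp
  qed
  have sym: "b1 n (- x) = b1 n x" for n x
  proof (induction n arbitrary: x rule: less_induct)
    case (less n)
    consider "n = 0" | "n = 1" | k where "n = Suc (Suc k)" by (metis One_nat_def not0_implies_Suc)
    then show ?case
    proof cases
      case 3
      have "- x + 1 = - (x - 1)" "- x - 1 = - (x + 1)" by simp_all
      then have "b1 (Suc k) (- x + 1) = b1 (Suc k) (x - 1)" "b1 (Suc k) (- x - 1) = b1 (Suc k) (x + 1)"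
        using less.IH[of "Suc k" "x - 1"] less.IH[of "Suc k" "x + 1"] 3 by simp_all
      with less.IH[of k x] show ?thesis unfolding 3 wave by simp
    qed (simp_all add: b0 bS)
  qed
  \<comment> \<open>The source must be removed before stepping back from time 0: at
    \<open>x = 0\<close> it changes 1 into 1 - 2 = -1, which is the origin of the minus sign in
    front of \<open>b2\<close> for negative times.\<close>
  have backward: "(\<forall>x. r1 x (- int n) = b1 n x) \<and>
      (\<forall>x. r2 x (- int n) - (if x = 0 \<and> n = 0 then 2 else 0) = - b2 n (- x + 1))" for n
  proof (induction n)
    case 0
    then show ?case by (simp add: r0 b0)
  next
    case (Suc n)
    have IH: "r1 y (- int n) = b1 n y" "r2 y (- int n) - (if y = 0 \<and> - int n = 0 then 2 else 0) = - b2 n (- y + 1)" for y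
      using Suc by simp_all
    have "r1 x (- int n - 1) = b1 (Suc n) (- x)" for x
      unfolding r(3) IH bS using sym[of n "x - 1"] by (simp add: algebra_simps)
    moreover have "r2 x (- int n - 1) = - b2 (Suc n) (- x + 1)" for x
      unfolding r(4) IH bS using sym[of n x] by (simp add: algebra_simps)
    moreover have "- int n - 1 = - int (Suc n)" by simp
    ultimately show ?case by (simp add: sym)
  qed
  have "r1 x t = b1 (nat \<bar>t\<bar>) x"
    using forward[of "nat t"] backward[of "nat (- t)"] by (cases "t < 0") auto
  moreover have "r2 x t = (if t < 0 then - b2 (nat \<bar>t\<bar>) (- x + 1) else b2 (nat \<bar>t\<bar>) (x + 1))"
    using forward[of "nat t"] backward[of "nat (- t)"] by (cases "t < 0") auto
  ultimately show "Re (sol1 (m * \<epsilon>) 0 x t) = a1 (\<epsilon> * of_int x) (\<epsilon> * of_nat (nat \<bar>t\<bar> + 1)) m \<epsilon>"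
    "Re (sol2 (m * \<epsilon>) 0 x t) = (if t < 0 then - a2 (\<epsilon> * of_int (- x + 1)) (\<epsilon> * of_nat (nat \<bar>t\<bar> + 1)) m \<epsilon>
        else a2 (\<epsilon> * of_int (x + 1)) (\<epsilon> * of_nat (nat \<bar>t\<bar> + 1)) m \<epsilon>)"
    unfolding r1_def r2_def b1_def b2_def \<mu>_def .
qed

lemma tendsto_at_right_eventually_zero:
  fixes f :: "real \<Rightarrow> real"
  assumes "(f \<longlongrightarrow> L) (at_right 0)" "\<And>\<delta>. 0 < \<delta> \<Longrightarrow> \<delta> < 1 \<Longrightarrow> f \<delta> = 0"
  shows "L = 0"
proof -
  have "\<forall>\<^sub>F \<delta> in at_right 0. f \<delta> = 0"
    using eventually_at_right_less[of 0] eventually_at_right[of 0 1] assms(2)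
    by (auto simp: eventually_at_right[of 0 1] intro!: exI[of _ 1])
  then have "(f \<longlongrightarrow> 0) (at_right 0)" by (rule tendsto_eventually)
  with assms(1) show ?thesis by (intro tendsto_unique) auto
qed

text \<open>The parity argument rests on uniqueness and so on \<delta> > 0; the vanishing of the
  real or imaginary part is carried to \<delta> = 0 by the limit.\<close>

lemma sol_limit_parity:
  assumes "\<mu> > 0"
  shows "even (x + t + 1) \<Longrightarrow> Im (sol1 \<mu> 0 x t) = 0" "odd (x + t + 1) \<Longrightarrow> Re (sol1 \<mu> 0 x t) = 0"
    and "even (x + t + 2) \<Longrightarrow> Im (sol2 \<mu> 0 x t) = 0" "odd (x + t + 2) \<Longrightarrow> Re (sol2 \<mu> 0 x t) = 0"
proof -
  have par: "even (x + t + 1) \<Longrightarrow> Im (sol1 \<mu> \<delta> x t) = 0" "odd (x + t + 1) \<Longrightarrow> Re (sol1 \<mu> \<delta> x t) = 0"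
    "even (x + t + 2) \<Longrightarrow> Im (sol2 \<mu> \<delta> x t) = 0" "odd (x + t + 2) \<Longrightarrow> Re (sol2 \<mu> \<delta> x t) = 0"
    if "0 < \<delta>" "\<delta> < 1" for \<delta>
    by (rule evol_parity[OF _ that _ evol_sol[OF assms _ that(2)] sol_square_summable[OF assms that]];
        use assms that in simp)+
  note lim = tendsto_sol[OF assms, of x t]
  show "even (x + t + 1) \<Longrightarrow> Im (sol1 \<mu> 0 x t) = 0"
    using tendsto_at_right_eventually_zero[OF tendsto_Im[OF lim(1)] par(1)] by simp
  show "odd (x + t + 1) \<Longrightarrow> Re (sol1 \<mu> 0 x t) = 0"
    using tendsto_at_right_eventually_zero[OF tendsto_Re[OF lim(1)] par(2)] by simp
  show "even (x + t + 2) \<Longrightarrow> Im (sol2 \<mu> 0 x t) = 0"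
    using tendsto_at_right_eventually_zero[OF tendsto_Im[OF lim(2)] par(3)] by simp
  show "odd (x + t + 2) \<Longrightarrow> Re (sol2 \<mu> 0 x t) = 0"
    using tendsto_at_right_eventually_zero[OF tendsto_Re[OF lim(2)] par(4)] by simp
qed

theorem theorem1:
  fixes \<epsilon> m :: real
  assumes "\<epsilon> > 0" and "m > 0"
  shows "(\<forall>\<delta>\<in>{0<..<1}. \<exists>A1 A2. dirac_axioms m \<epsilon> \<delta> A1 A2 \<and>
            (\<forall>B1 B2. dirac_axioms m \<epsilon> \<delta> B1 B2 \<longrightarrow>
               (\<forall>p\<in>Leps \<epsilon>. B1 p = A1 p \<and> B2 p = A2 p)))
       \<and> (\<forall>A1 A2 :: real \<Rightarrow> real \<times> real \<Rightarrow> complex.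
            (\<forall>\<delta>\<in>{0<..<1}. dirac_axioms m \<epsilon> \<delta> (A1 \<delta>) (A2 \<delta>)) \<longrightarrow>
            (\<forall>i j :: int. \<forall>k::nat\<in>{1,2}.
               let x = \<epsilon> * of_int i; t = \<epsilon> * of_int j;
                   Ak = (if k = 1 then A1 else A2) in
               \<exists>L. ((\<lambda>\<delta>. Ak \<delta> (x,t)) \<longlongrightarrow> L) (at_right 0) \<and>
                 (even (i + j + int k) \<longrightarrow>
                    (k = 1 \<longrightarrow> L = complex_of_real (a1 x (\<bar>t\<bar> + \<epsilon>) m \<epsilon>)) \<and>
                    (k = 2 \<longrightarrow> L = complex_of_real
                       (if t < 0 then - a2 (- x + \<epsilon>) (\<bar>t\<bar> + \<epsilon>) m \<epsilon>
                        else a2 (x + \<epsilon>) (\<bar>t\<bar> + \<epsilon>) m \<epsilon>))) \<and>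
                 (odd (i + j + int k) \<longrightarrow> Re L = 0)))"
proof (intro conjI allI impI ballI)
  fix \<delta> :: real assume "\<delta> \<in> {0<..<1}"
  then have \<delta>: "0 < \<delta>" "0 \<le> \<delta>" "\<delta> < 1" by auto
  have "m * \<epsilon> > 0" using assms by simp
  from dirac_axioms_if_evol[OF assms(1) evol_sol[OF this \<delta>(2,3)] sol_square_summable[OF this \<delta>(1,3)]]
  obtain A1 A2 where "dirac_axioms m \<epsilon> \<delta> A1 A2" by blast
  then show "\<exists>A1 A2. dirac_axioms m \<epsilon> \<delta> A1 A2 \<and>
            (\<forall>B1 B2. dirac_axioms m \<epsilon> \<delta> B1 B2 \<longrightarrow>
               (\<forall>p\<in>Leps \<epsilon>. B1 p = A1 p \<and> B2 p = A2 p))"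
    using dirac_axioms_unique[OF assms \<delta>(1,3)] by blast
next
  fix A1 A2 :: "real \<Rightarrow> real \<times> real \<Rightarrow> complex" and i j :: int and k :: nat
  assume A: "\<forall>\<delta>\<in>{0<..<1}. dirac_axioms m \<epsilon> \<delta> (A1 \<delta>) (A2 \<delta>)" and "k \<in> {1, 2}"
  define x where "x = \<epsilon> * of_int i"
  define t where "t = \<epsilon> * of_int j"
  define \<mu> where "\<mu> = m * \<epsilon>"
  have "\<mu> > 0" using assms by (simp add: \<mu>_def)
  note lim = tendsto_sol[OF this, of i j] and par = sol_limit_parity[OF this, of i j]
  have ev: "\<forall>\<^sub>F \<delta> in at_right (0::real). \<delta> \<in> {0<..<1}"
    by (rule eventually_at_right_real) simp
  have eq: "A1 \<delta> (x, t) = sol1 \<mu> \<delta> i j" "A2 \<delta> (x, t) = sol2 \<mu> \<delta> i j" if "\<delta> \<in> {0<..<1}" for \<delta>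
    unfolding x_def t_def \<mu>_def using that A by (auto intro!: dirac_axioms_eq_sol[OF assms])
  have L1: "((\<lambda>\<delta>. A1 \<delta> (x, t)) \<longlongrightarrow> sol1 \<mu> 0 i j) (at_right 0)"
    by (rule Lim_transform_eventually[OF lim(1)], rule eventually_mono[OF ev]) (simp add: eq)
  have L2: "((\<lambda>\<delta>. A2 \<delta> (x, t)) \<longlongrightarrow> sol2 \<mu> 0 i j) (at_right 0)"
    by (rule Lim_transform_eventually[OF lim(2)], rule eventually_mono[OF ev]) (simp add: eq)
  have "\<bar>t\<bar> + \<epsilon> = \<epsilon> * of_nat (nat \<bar>j\<bar> + 1)" "t < 0 \<longleftrightarrow> j < 0"
    "x + \<epsilon> = \<epsilon> * of_int (i + 1)" "- x + \<epsilon> = \<epsilon> * of_int (- i + 1)"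
    using assms(1) by (simp_all add: x_def t_def abs_mult algebra_simps mult_less_0_iff)
  \<comment> \<open>These are real parts only; when \<open>i + j + k\<close> is even, parity makes
    the imaginary part of the limit vanish, so they give the whole limit.\<close>
  then have R: "Re (sol1 \<mu> 0 i j) = a1 x (\<bar>t\<bar> + \<epsilon>) m \<epsilon>"
    "Re (sol2 \<mu> 0 i j) = (if t < 0 then - a2 (- x + \<epsilon>) (\<bar>t\<bar> + \<epsilon>) m \<epsilon> else a2 (x + \<epsilon>) (\<bar>t\<bar> + \<epsilon>) m \<epsilon>)"
    unfolding \<mu>_def Re_sol[OF assms] by (simp_all only: x_def)
  consider "k = 1" | "k = 2" using \<open>k \<in> {1, 2}\<close> by auto
  then have "\<exists>L. ((\<lambda>\<delta>. (if k = 1 then A1 else A2) \<delta> (x, t)) \<longlongrightarrow> L) (at_right 0) \<and>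
       (even (i + j + int k) \<longrightarrow>
          (k = 1 \<longrightarrow> L = complex_of_real (a1 x (\<bar>t\<bar> + \<epsilon>) m \<epsilon>)) \<and>
          (k = 2 \<longrightarrow> L = complex_of_real
             (if t < 0 then - a2 (- x + \<epsilon>) (\<bar>t\<bar> + \<epsilon>) m \<epsilon>
              else a2 (x + \<epsilon>) (\<bar>t\<bar> + \<epsilon>) m \<epsilon>))) \<and>
       (odd (i + j + int k) \<longrightarrow> Re L = 0)"
  proof cases
    case 1
    then show ?thesis using L1 par(1,2) R(1) by (intro exI[of _ "sol1 \<mu> 0 i j"]) (auto simp: complex_eq_iff)
  next
    case 2
    then show ?thesis using L2 par(3,4) R(2) by (intro exI[of _ "sol2 \<mu> 0 i j"]) (auto simp: complex_eq_iff)
  qed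
  then show "let x = \<epsilon> * of_int i; t = \<epsilon> * of_int j; Ak = (if k = 1 then A1 else A2) in
     \<exists>L. ((\<lambda>\<delta>. Ak \<delta> (x,t)) \<longlongrightarrow> L) (at_right 0) \<and>
       (even (i + j + int k) \<longrightarrow>
          (k = 1 \<longrightarrow> L = complex_of_real (a1 x (\<bar>t\<bar> + \<epsilon>) m \<epsilon>)) \<and>
          (k = 2 \<longrightarrow> L = complex_of_real
             (if t < 0 then - a2 (- x + \<epsilon>) (\<bar>t\<bar> + \<epsilon>) m \<epsilon>
              else a2 (x + \<epsilon>) (\<bar>t\<bar> + \<epsilon>) m \<epsilon>))) \<and>
       (odd (i + j + int k) \<longrightarrow> Re L = 0)"
    by (simp only: Let_def x_def t_def)
qed

end
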